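(* Let $n\ge 2$ be an integer. (a) There is a real $1$-parameter family $\{f_t\}_{t\in \mathbb R}$ of mutually incongruent holomorphic isometries $f_{t}:(\Delta,g_\Delta)\to (\Delta,g_\Delta)\times (\mathbb B^n,g_{\mathbb B^n})$. (b) More generally, there is a family $\{f_\zeta\}_{\zeta\in A_n}$ of holomorphic isometries $f_{\zeta}:(\Delta,g_\Delta)\to (\Delta,g_\Delta)\times (\mathbb B^n,g_{\mathbb B^n})$, where $A_n:=\left\{\xi\in \mathbb C: \frac{n-1}{n+1}<|\xi|<1\right\}$, such that for any $\zeta,\zeta'\in A_n$, $f_\zeta$ and $f_{\zeta'}$ are congruent to each other if and only if $|\zeta|=|\zeta'|$. (c) In addition, if $n\ge 3$, then there is a family $\{f_\zeta\}_{\zeta\in \Delta^*}$ of holomorphic isometries $f_{\zeta}:(\Delta,g_\Delta)\to (\Delta,g_\Delta)\times (\mathbb B^n,g_{\mathbb B^n})$, where $\Delta^*:=\Delta\smallsetminus\{0\}$, such that for any $\zeta,\zeta'\in \Delta^*$, $f_\zeta$ and $f_{\zeta'}$ are congruent to each other if and only if $|\zeta|=|\zeta'|$.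
   Context: $\mathbb B^n=\{z\in\mathbb C^n:\sum_{j}|z_j|^2<1\}$ is the complex unit ball and $\Delta=\mathbb B^1$. The metric $g_{\mathbb B^n}$ is the Kähler metric with Kähler form $-\sqrt{-1}\,\partial\overline\partial\log(1-\sum_{j=1}^n|z_j|^2)$. A holomorphic map $f=(f_1,f_2):\Delta\to\Delta\times\mathbb B^n$ is a holomorphic isometry $(\Delta,g_\Delta)\to(\Delta,g_\Delta)\times(\mathbb B^n,g_{\mathbb B^n})$ if $g_\Delta=f_1^*g_\Delta+f_2^*g_{\mathbb B^n}$. Two such holomorphic isometries $F_1,F_2$ are congruent if $F_1=\Psi\circ F_2\circ\phi$ for some $\phi\in\mathrm{Aut}(\Delta)$, $\Psi\in\mathrm{Aut}(\Delta\times\mathbb B^n)$ (biholomorphic automorphisms), and incongruent otherwise; a family is mutually incongruent if members with distinct parameters are incongruent. *)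

theory Defs
  imports "HOL-Analysis.Analysis"
begin

section \<open>Complex normed vector spaces\<close>

text \<open>
  A common interface to \<open>complex\<close>, \<open>complex ^ 'n\<close> and their products, so that holomorphic maps
  between open subsets of any of these spaces can be treated uniformly.
\<close>

class complex_normed_vector = real_normed_vector +
  fixes scaleC :: "complex \<Rightarrow> 'a \<Rightarrow> 'a"  (infixr \<open>*\<^sub>C\<close> 75)
  assumes scaleC_add_right: "c *\<^sub>C (x + y) = c *\<^sub>C x + c *\<^sub>C y"
    and scaleC_add_left: "(c + d) *\<^sub>C x = c *\<^sub>C x + d *\<^sub>C x"
    and scaleC_scaleC: "c *\<^sub>C d *\<^sub>C x = (c * d) *\<^sub>C x"
    and scaleR_scaleC: "r *\<^sub>R x = complex_of_real r *\<^sub>C x"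
    and norm_scaleC: "norm (c *\<^sub>C x) = cmod c * norm x"

instantiation complex :: complex_normed_vector
begin

definition scaleC_complex :: "complex \<Rightarrow> complex \<Rightarrow> complex"
  where "c *\<^sub>C x = c * x" for c x :: complex

instance
  by standard (simp_all add: scaleC_complex_def algebra_simps norm_mult scaleR_conv_of_real)

end

instantiation prod :: (complex_normed_vector, complex_normed_vector) complex_normed_vector
begin

definition scaleC_prod :: "complex \<Rightarrow> 'a \<times> 'b \<Rightarrow> 'a \<times> 'b"
  where "c *\<^sub>C x = (c *\<^sub>C fst x, c *\<^sub>C snd x)"

instance
proof
  fix c :: complex and x :: "'a \<times> 'b"
  have "(cmod c * norm (fst x))\<^sup>2 + (cmod c * norm (snd x))\<^sup>2
      = (cmod c)\<^sup>2 * ((norm (fst x))\<^sup>2 + (norm (snd x))\<^sup>2)"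
    by (simp add: power_mult_distrib algebra_simps)
  then show "norm (c *\<^sub>C x) = cmod c * norm x"
    by (simp add: scaleC_prod_def norm_prod_def norm_scaleC real_sqrt_mult)
qed (simp_all add: scaleC_prod_def scaleC_add_right scaleC_add_left scaleC_scaleC scaleR_scaleC
      scaleR_prod_def)

end

instantiation vec :: (complex_normed_vector, finite) complex_normed_vector
begin

definition scaleC_vec :: "complex \<Rightarrow> 'a ^ 'b \<Rightarrow> 'a ^ 'b"
  where "c *\<^sub>C x = (\<chi> i. c *\<^sub>C (x $ i))"

instance
proof
  fix c :: complex and x :: "'a ^ 'b"
  show "norm (c *\<^sub>C x) = cmod c * norm x"
    by (simp add: scaleC_vec_def norm_vec_def norm_scaleC L2_set_right_distrib)
qed (simp_all add: scaleC_vec_def vec_eq_iff scaleC_add_right scaleC_add_left scaleC_scaleC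
      scaleR_scaleC)

end


section \<open>Holomorphic maps and biholomorphic automorphisms\<close>

text \<open>Only meant for open sets \<open>S\<close>.\<close>

definition holomorphic_map_on ::
  "('a::complex_normed_vector \<Rightarrow> 'b::complex_normed_vector) \<Rightarrow> 'a set \<Rightarrow> bool"
  where "holomorphic_map_on f S \<longleftrightarrow>
    (\<forall>z\<in>S. \<exists>D. (f has_derivative D) (at z) \<and> (\<forall>c v. D (c *\<^sub>C v) = c *\<^sub>C D v))"

lemma holomorphic_map_on_complex_iff:
  fixes f :: "complex \<Rightarrow> complex"
  assumes "open S"
  shows "holomorphic_map_on f S \<longleftrightarrow> f holomorphic_on S"
proof -
  have "(\<exists>D. (f has_derivative D) (at z) \<and> (\<forall>c v. D (c *\<^sub>C v) = c *\<^sub>C D v))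
      \<longleftrightarrow> (\<exists>d. (f has_field_derivative d) (at z))" for z
  proof
    assume "\<exists>D. (f has_derivative D) (at z) \<and> (\<forall>c v. D (c *\<^sub>C v) = c *\<^sub>C D v)"
    then obtain D where D: "(f has_derivative D) (at z)" "\<And>c v. D (c * v) = c * D v"
      by (auto simp: scaleC_complex_def)
    have "D v = D 1 * v" for v
      using D(2)[of v 1] by simp
    then have "D = (*) (D 1)"
      by (rule ext)
    with D(1) have "(f has_derivative (*) (D 1)) (at z)"
      by (rule back_subst[where P = "\<lambda>D. (f has_derivative D) (at z)"])
    then show "\<exists>d. (f has_field_derivative d) (at z)"
      unfolding has_field_derivative_def by (rule exI)
  next
    assume "\<exists>d. (f has_field_derivative d) (at z)"
    then obtain d where "(f has_derivative (*) d) (at z)"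
      unfolding has_field_derivative_def by blast
    moreover have "\<forall>c v. d * (c *\<^sub>C v) = c *\<^sub>C (d * v)"
      by (simp add: scaleC_complex_def)
    ultimately show "\<exists>D. (f has_derivative D) (at z) \<and> (\<forall>c v. D (c *\<^sub>C v) = c *\<^sub>C D v)"
      by (intro exI[of _ "(*) d"] conjI)
  qed
  then show ?thesis
    using assms
    by (simp add: holomorphic_map_on_def holomorphic_on_open)
qed

definition Aut :: "'a::complex_normed_vector set \<Rightarrow> ('a \<Rightarrow> 'a) set"
  where "Aut S = {f. holomorphic_map_on f S \<and> f ` S \<subseteq> S \<and>
    (\<exists>g. holomorphic_map_on g S \<and> g ` S \<subseteq> S \<and> (\<forall>z\<in>S. g (f z) = z \<and> f (g z) = z))}"


section \<open>The canonical Kaehler metric of the unit ball\<close>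

text \<open>
  \<open>del v F\<close> and \<open>delbar v F\<close> are the (1,0)-part and the (0,1)-part of the differential of \<open>F\<close>,
  evaluated at the real tangent vector \<open>v\<close>.  In coordinates they are
  \<open>\<Sum>j. (\<partial>F/\<partial>z\<^sub>j) v\<^sub>j\<close> and \<open>\<Sum>j. (\<partial>F/\<partial>cnj z\<^sub>j) (cnj v\<^sub>j)\<close>.
\<close>

definition del :: "'a::complex_normed_vector \<Rightarrow> ('a \<Rightarrow> complex) \<Rightarrow> 'a \<Rightarrow> complex"
  where "del v F z =
    (frechet_derivative F (at z) v - \<i> * frechet_derivative F (at z) (\<i> *\<^sub>C v)) / 2"

definition delbar :: "'a::complex_normed_vector \<Rightarrow> ('a \<Rightarrow> complex) \<Rightarrow> 'a \<Rightarrow> complex"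
  where "delbar v F z =
    (frechet_derivative F (at z) v + \<i> * frechet_derivative F (at z) (\<i> *\<^sub>C v)) / 2"

text \<open>
  The 2-form \<open>\<Sum>j k. (\<partial>\<^sup>2F/\<partial>z\<^sub>j \<partial>cnj z\<^sub>k) dz\<^sub>j \<and> d(cnj z\<^sub>k)\<close>, with the convention
  \<open>(\<alpha> \<and> \<beta>)(u, v) = \<alpha>(u) \<beta>(v) - \<alpha>(v) \<beta>(u)\<close>.
\<close>

definition deldelbar ::
  "('a::complex_normed_vector \<Rightarrow> complex) \<Rightarrow> 'a \<Rightarrow> 'a \<Rightarrow> 'a \<Rightarrow> complex"
  where "deldelbar F z u v = del u (delbar v F) z - del v (delbar u F) z"

text \<open>On \<open>complex ^ 'n\<close> the norm is the Euclidean one, so \<open>(norm w)\<^sup>2 = \<Sum>j. (cmod (w $ j))\<^sup>2\<close>.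
  The form is real because the potential is; \<open>Re\<close> only adjusts the type.\<close>

definition ball_kaehler_form :: "'a::complex_normed_vector \<Rightarrow> 'a \<Rightarrow> 'a \<Rightarrow> real"
  where "ball_kaehler_form z u v =
    Re (- \<i> * deldelbar (\<lambda>w. complex_of_real (ln (1 - (norm w)\<^sup>2))) z u v)"

text \<open>The Riemannian metric \<open>g(u, v) = \<omega>(u, J v)\<close>, where \<open>J\<close> is multiplication by \<open>\<i>\<close>.\<close>

definition ball_metric :: "'a::complex_normed_vector \<Rightarrow> 'a \<Rightarrow> 'a \<Rightarrow> real"
  where "ball_metric z u v = ball_kaehler_form z u (\<i> *\<^sub>C v)"


section \<open>Holomorphic isometries and congruence\<close>

abbreviation disc :: "complex set"
  where "disc \<equiv> ball 0 1"

abbreviation disc_times_ball :: "(complex \<times> (complex ^ 'n)) set"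
  where "disc_times_ball \<equiv> ball 0 1 \<times> ball 0 1"

definition pullback ::
  "('a::real_normed_vector \<Rightarrow> 'b::real_normed_vector) \<Rightarrow> ('b \<Rightarrow> 'b \<Rightarrow> 'b \<Rightarrow> real)
    \<Rightarrow> 'a \<Rightarrow> 'a \<Rightarrow> 'a \<Rightarrow> real"
  where "pullback f g z u v =
    g (f z) (frechet_derivative f (at z) u) (frechet_derivative f (at z) v)"

definition holomorphic_isometry :: "(complex \<Rightarrow> complex \<times> (complex ^ 'n)) \<Rightarrow> bool"
  where "holomorphic_isometry f \<longleftrightarrow>
    holomorphic_map_on f disc \<and> f ` disc \<subseteq> disc_times_ball \<and>
    (\<forall>z\<in>disc. \<forall>u v. ball_metric z u v =
      pullback (fst \<circ> f) ball_metric z u v + pullback (snd \<circ> f) ball_metric z u v)"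

definition congruent_maps ::
  "(complex \<Rightarrow> complex \<times> (complex ^ 'n)) \<Rightarrow> (complex \<Rightarrow> complex \<times> (complex ^ 'n)) \<Rightarrow> bool"
  where "congruent_maps F G \<longleftrightarrow>
    (\<exists>\<phi>\<in>Aut disc. \<exists>\<Psi>\<in>Aut disc_times_ball. \<forall>z\<in>disc. F z = \<Psi> (G (\<phi> z)))"

end

theory Submission
  imports Defs "HOL-Complex_Analysis.Complex_Analysis"
begin

text \<open>
  For \<open>0 < c < 1/3\<close> let \<open>R w = w (1 + c w\<^sup>2) / (c + w\<^sup>2)\<close> and, for orthonormal \<open>e1\<close>, \<open>e2\<close>,
  \<open>V w = sqrt (1 - c\<^sup>2) w / (c + w\<^sup>2) (e1 + w e2)\<close>.  Then
  \<open>1 - R w * cnj (R v) = (1 - w * cnj v) (1 - \<langle>V w, V v\<rangle>)\<close>.  On the part \<open>D\<close> of the disc mapped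
  into the disc, \<open>R\<close> is injective by the reverse Cauchy--Schwarz inequality, and it is onto the disc
  by Brouwer's fixed point theorem; with \<open>f1\<close> its inverse and \<open>f2 = V \<circ> f1\<close>, the logarithm of the
  identity makes \<open>(f1, f2)\<close> an isometry.  The share of the metric carried by \<open>f1\<close> is at most
  \<open>c\<^sup>2\<close>, with equality at the origin.  Since \<open>c\<^sup>2 < 1/2\<close>, the Kobayashi metric of the product pulls
  back to the square root of the share of \<open>f2\<close>, so \<open>c\<close> is a congruence invariant.  Composing with
  a real parameter gives (a), and \<open>c = cmod \<zeta> / 3\<close> gives (b) and (c).
\<close>

section \<open>The Hermitian form and the ball metric\<close>

text \<open>The Hermitian inner product, linear in \<open>x\<close> and conjugate linear in
  \<open>y\<close>, recovered from its real part, so that \<open>complex\<close> and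
  \<open>complex ^ 'n\<close> are treated alike.\<close>

definition hinner :: "'a::{real_inner,complex_normed_vector} \<Rightarrow> 'a \<Rightarrow> complex"
  where "hinner x y = Complex (x \<bullet> y) (x \<bullet> (\<i> *\<^sub>C y))"

lemma scaleC_decomp:
  fixes x :: "'a::complex_normed_vector"
  shows "c *\<^sub>C x = Re c *\<^sub>R x + Im c *\<^sub>R (\<i> *\<^sub>C x)"
  by (metis complex_eq mult.commute scaleC_add_left scaleC_scaleC scaleR_scaleC)

lemma scaleC_ii: "\<i> *\<^sub>C \<i> *\<^sub>C (x::'a::complex_normed_vector) = - x"
  using scaleR_scaleC[of "-1" x] by (simp add: scaleC_scaleC)

lemma scaleC_zero_left [simp]: "0 *\<^sub>C (x::'a::complex_normed_vector) = 0"
  using norm_scaleC[of 0 x] by simp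

lemma scaleC_zero_right [simp]: "c *\<^sub>C (0::'a::complex_normed_vector) = 0"
  using norm_scaleC[of c "0::'a"] by simp

lemma scaleC_one [simp]: "1 *\<^sub>C (x::'a::complex_normed_vector) = x"
  using scaleR_scaleC[of 1 x] by simp

text \<open>Multiplication by \<open>\<i>\<close> preserves the norm, and the norm determines the
  real inner product by polarization.\<close>

lemma inner_ii:
  fixes x y :: "'a::{real_inner,complex_normed_vector}"
  shows "(\<i> *\<^sub>C x) \<bullet> (\<i> *\<^sub>C y) = x \<bullet> y"
  by (simp add: dot_norm scaleC_add_right[symmetric] norm_scaleC)

lemma inner_i_left:
  fixes x y :: "'a::{real_inner,complex_normed_vector}"
  shows "(\<i> *\<^sub>C x) \<bullet> y = - (x \<bullet> (\<i> *\<^sub>C y))"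
  using inner_ii[of x "\<i> *\<^sub>C y"] by (simp add: scaleC_ii)

lemma hinner_commute: "hinner y x = cnj (hinner x y)"
  by (simp add: hinner_def complex_eq_iff inner_commute[of y] inner_i_left)

lemma hinner_add_left: "hinner (x + y) z = hinner x z + hinner y z"
  by (simp add: hinner_def complex_eq_iff inner_add_left)

lemma hinner_add_right: "hinner x (y + z) = hinner x y + hinner x z"
  by (simp add: hinner_def complex_eq_iff inner_add_right scaleC_add_right)

lemma hinner_scaleC_left: "hinner (c *\<^sub>C x) y = c * hinner x y"
  by (subst scaleC_decomp)
    (simp add: hinner_def complex_eq_iff inner_add_left inner_i_left scaleC_ii)

lemma hinner_scaleC_right: "hinner x (c *\<^sub>C y) = cnj c * hinner x y"
  by (metis complex_cnj_mult hinner_commute hinner_scaleC_left)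

lemma hinner_diff_left: "hinner (x - y) z = hinner x z - hinner y z"
  by (simp add: hinner_def complex_eq_iff inner_diff_left)

lemma hinner_zero_right [simp]: "hinner x 0 = 0"
  by (simp add: hinner_def complex_eq_iff)

lemma hinner_self: "hinner x x = of_real ((norm x)\<^sup>2)"
proof -
  have "x \<bullet> (\<i> *\<^sub>C x) = 0"
    using inner_i_left[of x x] by (simp add: inner_commute)
  then show ?thesis
    by (simp add: hinner_def complex_eq_iff power2_norm_eq_inner)
qed

text \<open>A unit scalar \<open>c\<close> rotates \<open>hinner x y\<close> onto the nonnegative
  reals, where it is a real inner product subject to Cauchy--Schwarz.\<close>

lemma cmod_hinner_le: "cmod (hinner x y) \<le> norm x * norm y"
proof (cases "hinner x y = 0")
  case False
  define c where "c = cnj (hinner x y) / cmod (hinner x y)"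
  have c: "cmod c = 1"
    using False by (simp add: c_def norm_divide)
  have "hinner (c *\<^sub>C x) y = of_real (cmod (hinner x y))"
    using False complex_norm_square[of "hinner x y"]
    by (simp add: hinner_scaleC_left c_def field_simps power2_eq_square)
  then have "cmod (hinner x y) = (c *\<^sub>C x) \<bullet> y"
    by (metis Re_complex_of_real complex.sel(1) hinner_def)
  also have "\<dots> \<le> norm (c *\<^sub>C x) * norm y"
    by (rule norm_cauchy_schwarz)
  finally show ?thesis
    by (simp add: norm_scaleC c)
qed simp

lemma hinner_complex: "hinner x y = x * cnj y"
  by (simp add: hinner_def complex_eq_iff inner_complex_def scaleC_complex_def)

lemma bounded_bilinear_hinner: "bounded_bilinear hinner"
proof
  show "\<exists>K. \<forall>a b::'a. cmod (hinner a b) \<le> norm a * norm b * K"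
    by (intro exI[of _ 1] allI) (simp add: cmod_hinner_le)
qed (simp_all add: hinner_add_left hinner_add_right scaleR_scaleC hinner_scaleC_left
    hinner_scaleC_right scaleC_complex_def)

lemmas bounded_linear_hinner_left = bounded_bilinear.bounded_linear_left[OF bounded_bilinear_hinner]
lemmas has_derivative_hinner_left = bounded_linear.has_derivative[OF bounded_linear_hinner_left]

lemma bounded_linear_scaleC_left:
  "bounded_linear (\<lambda>c. c *\<^sub>C (x::'a::complex_normed_vector))"
  by (rule bounded_linear_intro[where K = "norm x"])
    (simp_all add: scaleC_add_left norm_scaleC scaleR_scaleC scaleC_scaleC scaleC_complex_def)

lemma one_minus_norm_sq_pos:
  fixes x :: "'a::real_normed_vector"
  shows "norm x < 1 \<Longrightarrow> 0 < 1 - (norm x)\<^sup>2"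
  by (simp add: abs_square_less_1)

lemma has_derivative_one_minus_norm_sq:
  fixes w :: "'a::real_inner"
  shows "((\<lambda>w. 1 - (norm w)\<^sup>2) has_derivative (\<lambda>v. - 2 * (w \<bullet> v))) (at w)"
  unfolding power2_norm_eq_inner
  by (auto intro!: derivative_eq_intros simp: inner_commute)

section \<open>The ball metric computed from its potential\<close>

abbreviation ball_potential :: "'a::complex_normed_vector \<Rightarrow> complex"
  where "ball_potential \<equiv> \<lambda>w. complex_of_real (ln (1 - (norm w)\<^sup>2))"

text \<open>The real differential has numerator \<open>- 2 * (w \<bullet> v)\<close>; taking the
  part that is conjugate linear in \<open>v\<close> replaces \<open>2 * (w \<bullet> v)\<close> by
  \<open>hinner w v\<close>.\<close>

lemma delbar_ball_potential:
  fixes w :: "'a::{real_inner,complex_normed_vector}"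
  assumes "norm w < 1"
  shows "delbar v ball_potential w = - hinner w v / of_real (1 - (norm w)\<^sup>2)"
proof -
  define d where "d = 1 - (norm w)\<^sup>2"
  have pos: "d > 0"
    using one_minus_norm_sq_pos[OF assms] by (simp add: d_def)
  have "(ball_potential has_derivative (\<lambda>v. of_real (- 2 * (w \<bullet> v) / d))) (at w)"
    by (rule has_derivative_of_real has_derivative_eq_rhs[OF has_derivative_ln]
      has_derivative_one_minus_norm_sq pos[unfolded d_def])+ (simp add: field_simps d_def)
  then have "frechet_derivative ball_potential (at w) = (\<lambda>v. of_real (- 2 * (w \<bullet> v) / d))"
    by (metis frechet_derivative_at)
  then show ?thesis
    using pos unfolding d_def[symmetric] by (simp add: delbar_def hinner_def complex_eq_iff)
qed

text \<open>The complex Hessian of \<open>- ln (1 - (norm w)\<^sup>2)\<close>, a Hermitian form in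
  \<open>u\<close> and \<open>v\<close>.\<close>

definition ball_form :: "'a::{real_inner,complex_normed_vector} \<Rightarrow> 'a \<Rightarrow> 'a \<Rightarrow> complex"
  where "ball_form w u v = hinner u v / of_real (1 - (norm w)\<^sup>2)
    + hinner u w * hinner w v / of_real ((1 - (norm w)\<^sup>2)\<^sup>2)"

lemma del_delbar_ball_potential:
  fixes w :: "'a::{real_inner,complex_normed_vector}"
  assumes "norm w < 1"
  shows "del u (delbar v ball_potential) w = - ball_form w u v"
proof -
  define d where "d = 1 - (norm w)\<^sup>2"
  have pos: "d > 0"
    using one_minus_norm_sq_pos[OF assms] by (simp add: d_def)
  define D where "D = (\<lambda>x. - (hinner x v / of_real d
      + hinner w v * of_real (2 * (w \<bullet> x)) / of_real (d\<^sup>2)))"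
  have "((\<lambda>w. - hinner w v / of_real (1 - (norm w)\<^sup>2)) has_derivative
      (\<lambda>x. (- hinner x v * of_real (1 - (norm w)\<^sup>2) - (- hinner w v) * of_real (- 2 * (w \<bullet> x)))
        / (of_real (1 - (norm w)\<^sup>2) * of_real (1 - (norm w)\<^sup>2)))) (at w)"
    using pos unfolding d_def
    by (intro has_derivative_divide' has_derivative_minus has_derivative_hinner_left
        has_derivative_ident has_derivative_of_real has_derivative_one_minus_norm_sq)
      (metis less_irrefl of_real_eq_0_iff)
  also have "(\<lambda>x. (- hinner x v * of_real (1 - (norm w)\<^sup>2) - (- hinner w v) * of_real (- 2 * (w \<bullet> x)))
        / (of_real (1 - (norm w)\<^sup>2) * of_real (1 - (norm w)\<^sup>2))) = D"
    using pos unfolding D_def d_def[symmetric]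
    by (simp add: fun_eq_iff field_simps power2_eq_square)
  finally have "(delbar v ball_potential has_derivative D) (at w)"
    by (rule has_derivative_transform_within_open[of _ _ _ _ "ball 0 1"])
      (use assms in \<open>auto simp: delbar_ball_potential\<close>)
  then have *: "frechet_derivative (delbar v ball_potential) (at w) = D"
    by (metis frechet_derivative_at)
  \<comment> \<open>This is the complex linear part that \<open>del\<close> extracts from
    \<open>2 * (w \<bullet> u)\<close>, the real differential of the squared norm.\<close>
  have "hinner u w = of_real (w \<bullet> u) - \<i> * of_real (w \<bullet> (\<i> *\<^sub>C u))"
    using inner_i_left[of u w] by (simp add: hinner_def complex_eq_iff inner_commute)
  then show ?thesis
    using pos unfolding del_def * D_def ball_form_def hinner_scaleC_left d_def[symmetric]
    by (simp only:) (simp add: field_simps)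
qed

lemma ball_form_commute: "ball_form w v u = cnj (ball_form w u v)"
  unfolding ball_form_def
  by (subst hinner_commute[of v u], subst hinner_commute[of v w], subst hinner_commute[of w u]) simp

text \<open>Inserting \<open>\<i> *\<^sub>C v\<close> turns the antisymmetrised form into the sum of
  \<open>ball_form w u v\<close> and its conjugate; hence the real part and the factor 2.\<close>

lemma ball_metric_eq:
  fixes w :: "'a::{real_inner,complex_normed_vector}"
  assumes "norm w < 1"
  shows "ball_metric w u v = 2 * Re (ball_form w u v)"
proof -
  have "ball_form w u (\<i> *\<^sub>C v) = - \<i> * ball_form w u v"
    by (simp add: ball_form_def hinner_scaleC_right algebra_simps)
  then show ?thesis
    by (simp add: ball_metric_def ball_kaehler_form_def deldelbar_def
        del_delbar_ball_potential[OF assms] ball_form_commute[of w "\<i> *\<^sub>C v" u])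
qed

text \<open>Inside the ball, half of \<open>ball_metric p a a\<close>. With this normalisation the
  square root is the Kobayashi metric of the ball.\<close>

definition ball_norm_sq :: "'a::{real_inner,complex_normed_vector} \<Rightarrow> 'a \<Rightarrow> real"
  where "ball_norm_sq p a = (norm a)\<^sup>2 / (1 - (norm p)\<^sup>2)
    + (cmod (hinner a p))\<^sup>2 / (1 - (norm p)\<^sup>2)\<^sup>2"

text \<open>The tangent vectors of a holomorphic curve at a point are complex multiples of a single
  vector, so on them the form reduces to one real number.\<close>

lemma ball_form_scaleC:
  "ball_form p (u *\<^sub>C a) (v *\<^sub>C a) = u * cnj v * of_real (ball_norm_sq p a)"
proof -
  have 1: "hinner (u *\<^sub>C a) (v *\<^sub>C a) = u * cnj v * of_real ((norm a)\<^sup>2)"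
    by (simp add: hinner_scaleC_left hinner_scaleC_right hinner_self)
  have "hinner a p * hinner p a = of_real ((cmod (hinner a p))\<^sup>2)"
    by (subst hinner_commute[of p a]) (rule complex_norm_square[symmetric])
  then have 2: "hinner (u *\<^sub>C a) p * hinner p (v *\<^sub>C a) = u * cnj v * of_real ((cmod (hinner a p))\<^sup>2)"
    by (simp add: hinner_scaleC_left hinner_scaleC_right mult_ac)
  show ?thesis
    unfolding ball_form_def ball_norm_sq_def 1 2 by (simp add: distrib_left)
qed

lemma ball_norm_sq_complex:
  fixes p a :: complex
  assumes "cmod p < 1"
  shows "ball_norm_sq p a = (cmod a)\<^sup>2 / (1 - (cmod p)\<^sup>2)\<^sup>2"
proof -
  define d where "d = 1 - (cmod p)\<^sup>2"
  have "d > 0"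
    using one_minus_norm_sq_pos[OF assms] by (simp add: d_def)
  have "ball_norm_sq p a = (cmod a)\<^sup>2 / d + (cmod a)\<^sup>2 * (1 - d) / d\<^sup>2"
    by (simp add: ball_norm_sq_def hinner_complex norm_mult power_mult_distrib d_def)
  also have "\<dots> = (cmod a)\<^sup>2 / d\<^sup>2"
    using \<open>d > 0\<close> by (simp add: field_simps power2_eq_square)
  finally show ?thesis
    by (simp add: d_def)
qed

text \<open>Everything is a polynomial in the two norms and the real and imaginary parts of
  \<open>hinner x p\<close>. For points of the ball the first two summands are nonnegative; dropping
  them leaves the reverse Cauchy--Schwarz inequality.\<close>

lemma hinner_gram_identity:
  "(cmod (1 - hinner x p))\<^sup>2 = (1 - (norm p)\<^sup>2) * (norm (x - p))\<^sup>2 + (cmod (hinner (x - p) p))\<^sup>2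
    + (1 - (norm x)\<^sup>2) * (1 - (norm p)\<^sup>2)"
proof -
  have 1: "(norm (x - p))\<^sup>2 = (norm x)\<^sup>2 - 2 * Re (hinner x p) + (norm p)\<^sup>2"
    by (simp add: power2_norm_eq_inner inner_diff_left inner_diff_right hinner_def inner_commute)
  have 2: "hinner (x - p) p = hinner x p - of_real ((norm p)\<^sup>2)"
    by (simp add: hinner_diff_left hinner_self)
  have "(1 - r)\<^sup>2 + i\<^sup>2 = (1 - P) * (X - 2 * r + P) + ((r - P)\<^sup>2 + i\<^sup>2) + (1 - X) * (1 - P)"
    for r i P X :: real
    by (simp add: algebra_simps power2_eq_square)
  then show ?thesis
    unfolding 1 2 cmod_power2 by simp
qed

section \<open>Holomorphic curves in the ball and the Schwarz--Pick inequality\<close>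

lemma has_field_derivative_hinner:
  assumes "(g has_derivative (\<lambda>h. h *\<^sub>C a)) (at z)"
  shows "((\<lambda>\<zeta>. hinner (g \<zeta>) y) has_field_derivative hinner a y) (at z)"
  unfolding has_field_derivative_def
  by (rule has_derivative_eq_rhs[OF has_derivative_hinner_left[OF assms]])
    (simp add: fun_eq_iff hinner_scaleC_left)

lemma holomorphic_map_on_curve:
  assumes "holomorphic_map_on g S" "z \<in> S"
  obtains a where "(g has_derivative (\<lambda>h. h *\<^sub>C a)) (at z)"
proof -
  have "\<exists>D. (g has_derivative D) (at z) \<and> (\<forall>c v. D (c *\<^sub>C v) = c *\<^sub>C D v)"
    using assms unfolding holomorphic_map_on_def by (rule bspec)
  then obtain D where D: "(g has_derivative D) (at z)" and scale: "\<And>c v. D (c *\<^sub>C v) = c *\<^sub>C D v"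
    by (elim exE conjE) simp
  have "D h = h *\<^sub>C D 1" for h
    using scale[of h 1] by (simp add: scaleC_complex_def)
  then have "D = (\<lambda>h. h *\<^sub>C D 1)" ..
  then have "(g has_derivative (\<lambda>h. h *\<^sub>C D 1)) (at z)"
    by (rule has_derivative_eq_rhs[OF D])
  with that show ?thesis .
qed

text \<open>Unless \<open>a\<close> has length zero, follow \<open>g\<close> by a scalar function on
  the ball that vanishes at \<open>g 0\<close>, stays below 1 in modulus and has derivative
  \<open>sqrt (ball_norm_sq (g 0) a)\<close> in direction \<open>a\<close>. The one-variable Schwarz
  lemma bounds this derivative by 1.\<close>

lemma schwarz_pick_ball:
  fixes g :: "complex \<Rightarrow> 'a::{real_inner,complex_normed_vector}"
  assumes hol: "holomorphic_map_on g disc" and sub: "g ` disc \<subseteq> ball 0 1"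
    and der: "(g has_derivative (\<lambda>h. h *\<^sub>C a)) (at 0)"
  shows "ball_norm_sq (g 0) a \<le> 1"
proof -
  define p where "p = g 0"
  define k where "k = 1 - (norm p)\<^sup>2"
  define T where "T = k * (norm a)\<^sup>2 + (cmod (hinner a p))\<^sup>2"
  have p: "norm p < 1"
    using sub by (simp add: p_def image_subset_iff)
  then have k: "k > 0"
    using one_minus_norm_sq_pos by (auto simp: k_def)
  have T0: "T \<ge> 0"
    using k by (simp add: T_def)
  have bn: "ball_norm_sq p a = T / k\<^sup>2"
    using k unfolding ball_norm_sq_def T_def k_def[symmetric]
    by (simp add: field_simps power2_eq_square)
  have ne: "1 - hinner x p \<noteq> 0" if "norm x < 1" for x
  proof
    assume "1 - hinner x p = 0"
    then have "1 \<le> norm x * norm p"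
      using cmod_hinner_le[of x p] by simp
    also have "\<dots> < 1 * 1"
      using that p by (intro mult_strict_mono') auto
    finally show False by simp
  qed
  show ?thesis
  proof (cases "T = 0")
    case True
    then show ?thesis
      using bn by (simp add: p_def)
  next
    case False
    with T0 have T: "T > 0" by simp
    \<comment> \<open>\<open>N x\<close> is \<open>ball_form p (x - p) a\<close> scaled by
      \<open>k\<^sup>2\<close>, and \<open>T\<close> is the squared length of \<open>a\<close>
      scaled in the same way. Hence \<open>f\<close> is, along \<open>g\<close>, a coordinate of a
      ball automorphism that moves \<open>p\<close> to the origin.\<close>
    define N where "N = (\<lambda>x. of_real k * hinner (x - p) a + hinner (x - p) p * hinner p a)"
    define f where "f = (\<lambda>\<zeta>. N (g \<zeta>) / (of_real (sqrt T) * (1 - hinner (g \<zeta>) p)))"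
    have deriv_f: "(f has_field_derivative
        ((of_real k * hinner b a + hinner b p * hinner p a)
            * (of_real (sqrt T) * (1 - hinner (g z) p))
          - N (g z) * (of_real (sqrt T) * (0 - hinner b p)))
        / ((of_real (sqrt T) * (1 - hinner (g z) p)) * (of_real (sqrt T) * (1 - hinner (g z) p)))) (at z)"
      if "(g has_derivative (\<lambda>h. h *\<^sub>C b)) (at z)" "z \<in> disc" for b z
    proof -
      note dg = has_field_derivative_hinner[OF that(1)]
      have "((\<lambda>\<zeta>. N (g \<zeta>)) has_field_derivative
          of_real k * (hinner b a - 0) + (hinner b p - 0) * hinner p a) (at z)"
        unfolding N_def hinner_diff_left
        by (intro DERIV_add DERIV_cmult DERIV_cmult_right DERIV_diff DERIV_const dg)
      then have "((\<lambda>\<zeta>. N (g \<zeta>)) has_field_derivative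
          of_real k * hinner b a + hinner b p * hinner p a) (at z)"
        by simp
      moreover have "((\<lambda>\<zeta>. of_real (sqrt T) * (1 - hinner (g \<zeta>) p)) has_field_derivative
          of_real (sqrt T) * (0 - hinner b p)) (at z)"
        by (intro DERIV_cmult DERIV_diff DERIV_const dg)
      moreover have "norm (g z) < 1"
        using sub that(2) by (auto simp: image_subset_iff)
      then have "of_real (sqrt T) * (1 - hinner (g z) p) \<noteq> 0"
        using T ne[of "g z"] by simp
      ultimately show ?thesis
        unfolding f_def by (rule DERIV_divide)
    qed
    have "f holomorphic_on disc"
      unfolding holomorphic_on_open[OF open_ball]
    proof
      fix z :: complex assume "z \<in> disc"
      then obtain b where "(g has_derivative (\<lambda>h. h *\<^sub>C b)) (at z)"
        using holomorphic_map_on_curve[OF hol] by blast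
      from deriv_f[OF this \<open>z \<in> disc\<close>] show "\<exists>f'. (f has_field_derivative f') (at z)" ..
    qed
    moreover have f0: "f 0 = 0"
      by (simp add: f_def N_def p_def[symmetric] hinner_diff_left)
    moreover have "cmod (f z) < 1" if z: "cmod z < 1" for z
    proof -
      define x where "x = g z"
      have x: "norm x < 1"
        using sub z by (simp add: x_def image_subset_iff)
      \<comment> \<open>Cauchy--Schwarz for the scaled form is reduced to that for the plane vectors
        \<open>(A, B)\<close> and \<open>(C, D)\<close>.\<close>
      define A B C D where "A = sqrt k * norm (x - p)" and "B = cmod (hinner (x - p) p)"
        and "C = sqrt k * norm a" and "D = cmod (hinner a p)"
      have "cmod (N x) \<le> k * cmod (hinner (x - p) a) + B * cmod (hinner p a)"
        unfolding N_def B_def using k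
        by (intro norm_triangle_le) (simp add: norm_mult)
      also have "cmod (hinner p a) = D"
        by (metis D_def complex_mod_cnj hinner_commute)
      also have "k * cmod (hinner (x - p) a) \<le> k * (norm (x - p) * norm a)"
        using k by (intro mult_left_mono cmod_hinner_le) simp
      also have "\<dots> = A * C"
        using k by (simp add: A_def C_def)
      finally have "cmod (N x) \<le> A * C + B * D" by simp
      then have "(cmod (N x))\<^sup>2 \<le> (A * C + B * D)\<^sup>2"
        by (intro power_mono) auto
      also have "\<dots> \<le> (A\<^sup>2 + B\<^sup>2) * (C\<^sup>2 + D\<^sup>2)"
        using zero_le_power2[of "A * D - B * C"] by (simp add: algebra_simps power2_eq_square)
      also have "C\<^sup>2 + D\<^sup>2 = T"
        using k by (simp add: C_def D_def T_def power_mult_distrib)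
      \<comment> \<open>\<open>hinner_gram_identity\<close> evaluates the scaled form at
        \<open>x - p\<close>; the subtracted product is positive inside the ball, which makes the
        bound strict.\<close>
      also have "A\<^sup>2 + B\<^sup>2 = (cmod (1 - hinner x p))\<^sup>2 - (1 - (norm x)\<^sup>2) * k"
        using k unfolding hinner_gram_identity k_def[symmetric]
        by (simp add: A_def B_def power_mult_distrib)
      also have "\<dots> * T < (cmod (1 - hinner x p))\<^sup>2 * T"
        using T k one_minus_norm_sq_pos[OF x] by (intro mult_strict_right_mono) auto
      also have "\<dots> = (cmod (of_real (sqrt T) * (1 - hinner x p)))\<^sup>2"
        using T by (simp add: norm_mult power_mult_distrib)
      finally have "cmod (N x) < cmod (of_real (sqrt T) * (1 - hinner x p))"
        by (rule power2_less_imp_less) simp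
      then show ?thesis
        using T by (simp add: f_def x_def[symmetric] norm_divide divide_less_eq)
    qed
    ultimately have "cmod (deriv f 0) \<le> 1"
      using Schwarz_Lemma(2)[of f 0] by simp
    moreover have "deriv f 0 = of_real (sqrt T / k)"
    proof -
      \<comment> \<open>Since the numerator vanishes at \<open>p\<close>, only its own derivative,
        which is \<open>T\<close> at 0, survives in the quotient rule.\<close>
      have N0: "N p = 0"
        by (simp add: N_def hinner_diff_left)
      have "of_real k * hinner a a + hinner a p * hinner p a = of_real T"
        using complex_norm_square[of "hinner a p"] hinner_commute[of p a]
        by (simp add: T_def hinner_self)
      moreover have "1 - hinner p p = of_real k"
        by (simp add: k_def hinner_self)
      ultimately have "deriv f 0 = of_real T * (of_real (sqrt T) * of_real k)
          / (of_real (sqrt T) * of_real k * (of_real (sqrt T) * of_real k))"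
        using DERIV_imp_deriv[OF deriv_f[OF der]] by (simp add: p_def[symmetric] N0)
      also have "\<dots> = of_real (T * (sqrt T * k) / (sqrt T * k * (sqrt T * k)))"
        by simp
      also have "T * (sqrt T * k) / (sqrt T * k * (sqrt T * k)) = sqrt T / k"
      proof -
        have "r * r * (r * k) / (r * k * (r * k)) = r / k" if "r > 0" for r
          using that k by simp
        from this[of "sqrt T"] T show ?thesis by simp
      qed
      finally show ?thesis .
    qed
    ultimately have "sqrt T / k \<le> 1"
      using T k by (simp add: norm_divide)
    then have "(sqrt T / k)\<^sup>2 \<le> 1"
      using T k by (simp add: abs_square_le_1)
    then show ?thesis
      using T bn by (simp add: power_divide p_def)
  qed
qed

text \<open>One logarithmic derivative in \<open>x\<close> and one in \<open>cnj y\<close>, taken on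
  the diagonal, give the complex Hessian of minus the logarithm of each factor. Having the identity
  for independent \<open>x\<close> and \<open>y\<close> makes both derivatives complex ones, and no
  branch of the logarithm is chosen.\<close>

lemma isometry_of_polarized_identity:
  fixes f :: "complex \<Rightarrow> complex" and g :: "complex \<Rightarrow> 'a::{real_inner,complex_normed_vector}"
  assumes z: "z \<in> disc" and fz: "cmod (f z) < 1" and gz: "norm (g z) < 1"
    and f: "(f has_field_derivative a) (at z)"
    and g: "(g has_derivative (\<lambda>h. h *\<^sub>C b)) (at z)"
    and eq: "\<And>x y. \<lbrakk>x \<in> disc; y \<in> disc\<rbrakk> \<Longrightarrow>
      1 - x * cnj y = (1 - f x * cnj (f y)) * (1 - hinner (g x) (g y))"
  shows "ball_norm_sq z 1 = ball_norm_sq (f z) a + ball_norm_sq (g z) b"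
proof -
  have ne: "1 - x * cnj y \<noteq> 0" if "cmod x < 1" "cmod y < 1" for x y :: complex
  proof
    assume "1 - x * cnj y = 0"
    then have "cmod (x * cnj y) = 1"
      by simp
    moreover have "cmod x * cmod y < 1 * 1"
      using that by (intro mult_strict_mono') auto
    ultimately show False by (simp add: norm_mult)
  qed
  \<comment> \<open>The logarithmic derivative in \<open>x\<close> at \<open>z\<close>, conjugated
    so that both sides are holomorphic in \<open>y\<close>.\<close>
  have log_deriv: "y / (1 - y * cnj z) =
      f y * cnj a / (1 - f y * cnj (f z)) + hinner (g y) b / (1 - hinner (g y) (g z))"
    if y: "y \<in> disc" for y
  proof -
    let ?L = "\<lambda>x. 1 - x * cnj y" and ?R = "\<lambda>x. (1 - f x * cnj (f y)) * (1 - hinner (g x) (g y))"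
    note [derivative_intros] = f has_field_derivative_hinner[OF g]
    have "(?L has_field_derivative - cnj y) (at z)"
      by (auto intro!: derivative_eq_intros)
    moreover have "(?R has_field_derivative - (a * cnj (f y)) * (1 - hinner (g z) (g y))
        - (1 - f z * cnj (f y)) * hinner b (g y)) (at z)"
      by (auto intro!: derivative_eq_intros simp: algebra_simps)
    then have "(?L has_field_derivative - (a * cnj (f y)) * (1 - hinner (g z) (g y))
        - (1 - f z * cnj (f y)) * hinner b (g y)) (at z)"
      by (rule has_field_derivative_transform_within_open[of _ _ _ disc]) (use z y eq in auto)
    ultimately have d: "- cnj y = - (a * cnj (f y)) * (1 - hinner (g z) (g y))
        - (1 - f z * cnj (f y)) * hinner b (g y)"
      by (rule DERIV_unique)
    have n: "1 - z * cnj y \<noteq> 0"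
      using ne z y by simp
    define A B where "A = 1 - f z * cnj (f y)" and "B = 1 - hinner (g z) (g y)"
    have AB: "1 - z * cnj y = A * B" "A \<noteq> 0" "B \<noteq> 0"
      using eq[OF z y] n by (auto simp: A_def B_def)
    have d': "cnj y = a * cnj (f y) * B + A * hinner b (g y)"
      using arg_cong[OF d, of uminus] by (simp add: A_def B_def)
    have "cnj y / (1 - z * cnj y) = a * cnj (f y) / A + hinner b (g y) / B"
      unfolding AB(1) using AB(2,3) by (subst d') (simp add: field_simps)
    then have "cnj (cnj y / (1 - z * cnj y)) = cnj (a * cnj (f y) / A + hinner b (g y) / B)"
      by (rule arg_cong)
    then show ?thesis
      by (simp add: A_def B_def hinner_commute[of b] hinner_commute[of "g z"] mult.commute)
  qed
  have nz: "1 - z * cnj z \<noteq> 0" "1 - f z * cnj (f z) \<noteq> 0" "1 - hinner (g z) (g z) \<noteq> 0"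
    using ne[of z z] z eq[OF z z] by auto
  \<comment> \<open>Differentiate once more, now in \<open>y\<close>, at
    \<open>y = z\<close>.\<close>
  let ?L = "\<lambda>y. y / (1 - y * cnj z)"
  let ?R = "\<lambda>y. f y * cnj a / (1 - f y * cnj (f z)) + hinner (g y) b / (1 - hinner (g y) (g z))"
  note [derivative_intros] = f has_field_derivative_hinner[OF g]
  let ?dL = "1 / (1 - z * cnj z)\<^sup>2"
  let ?dR = "a * cnj a / (1 - f z * cnj (f z))\<^sup>2 +
    (hinner b b * (1 - hinner (g z) (g z)) + hinner (g z) b * hinner b (g z)) /
      (1 - hinner (g z) (g z))\<^sup>2"
  have "(?L has_field_derivative ?dL) (at z)"
  proof -
    have "(?L has_field_derivative (1 * (1 - z * cnj z) - z * (0 - 1 * cnj z))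
        / ((1 - z * cnj z) * (1 - z * cnj z))) (at z)"
      using nz by (intro DERIV_divide DERIV_diff DERIV_const DERIV_cmult_right DERIV_ident)
    then show ?thesis
      by (simp add: power2_eq_square)
  qed
  moreover have "(?R has_field_derivative ?dR) (at z)"
  proof -
    have "(?R has_field_derivative
        (a * cnj a * (1 - f z * cnj (f z)) - f z * cnj a * (0 - a * cnj (f z)))
          / ((1 - f z * cnj (f z)) * (1 - f z * cnj (f z)))
        + (hinner b b * (1 - hinner (g z) (g z)) - hinner (g z) b * (0 - hinner b (g z)))
          / ((1 - hinner (g z) (g z)) * (1 - hinner (g z) (g z)))) (at z)"
      using nz by (intro DERIV_add DERIV_divide DERIV_diff DERIV_const DERIV_cmult_right f
          has_field_derivative_hinner g)
    also have "a * cnj a * (1 - f z * cnj (f z)) - f z * cnj a * (0 - a * cnj (f z)) = a * cnj a"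
      by (simp add: algebra_simps)
    finally show ?thesis
      by (simp add: power2_eq_square)
  qed
  then have "(?L has_field_derivative ?dR) (at z)"
    by (rule has_field_derivative_transform_within_open[of _ _ _ disc]) (use z log_deriv in auto)
  ultimately have key: "?dL = ?dR"
    by (rule DERIV_unique)
  define P where "P = 1 - (norm (g z))\<^sup>2"
  have P: "P \<noteq> 0" "1 - hinner (g z) (g z) = of_real P"
    using one_minus_norm_sq_pos[OF gz] by (auto simp: P_def hinner_self)
  have b: "hinner (g z) b * hinner b (g z) = of_real ((cmod (hinner b (g z)))\<^sup>2)"
    using complex_norm_square[of "hinner b (g z)"]
    by (subst hinner_commute[of "g z" b]) (simp add: mult.commute)
  have "ball_norm_sq (g z) b = ((norm b)\<^sup>2 * P + (cmod (hinner b (g z)))\<^sup>2) / P\<^sup>2"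
    using P(1) unfolding ball_norm_sq_def P_def[symmetric] by (simp add: field_simps power2_eq_square)
  moreover have "complex_of_real (1 / (1 - (cmod z)\<^sup>2)\<^sup>2) =
    of_real ((cmod a)\<^sup>2 / (1 - (cmod (f z))\<^sup>2)\<^sup>2 + ((norm b)\<^sup>2 * P + (cmod (hinner b (g z)))\<^sup>2) / P\<^sup>2)"
    using key unfolding P(2) b by (simp add: hinner_self complex_norm_square[symmetric])
  ultimately show ?thesis
    unfolding of_real_eq_iff using z fz by (simp add: ball_norm_sq_complex)
qed

section \<open>A bound on congruent maps\<close>

lemma holomorphic_map_on_curveI:
  assumes "\<And>z. z \<in> S \<Longrightarrow> \<exists>a. (g has_derivative (\<lambda>h. h *\<^sub>C a)) (at z)"
  shows "holomorphic_map_on g S"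
  unfolding holomorphic_map_on_def
proof
  fix z assume "z \<in> S"
  from assms[OF this] obtain a where "(g has_derivative (\<lambda>h. h *\<^sub>C a)) (at z)" ..
  then show "\<exists>D. (g has_derivative D) (at z) \<and> (\<forall>c v. D (c *\<^sub>C v) = c *\<^sub>C D v)"
    by (intro exI[of _ "\<lambda>h. h *\<^sub>C a"]) (simp add: scaleC_complex_def scaleC_scaleC)
qed

lemma holomorphic_map_on_compose:
  assumes "holomorphic_map_on f S" "f ` S \<subseteq> T" "holomorphic_map_on g T"
  shows "holomorphic_map_on (g \<circ> f) S"
  unfolding holomorphic_map_on_def
proof
  fix z assume z: "z \<in> S"
  obtain L where L: "(f has_derivative L) (at z)" "\<forall>c v. L (c *\<^sub>C v) = c *\<^sub>C L v"
    using bspec[OF assms(1)[unfolded holomorphic_map_on_def] z] by (elim exE conjE)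
  have "f z \<in> T"
    using assms(2) z by blast
  from bspec[OF assms(3)[unfolded holomorphic_map_on_def] this]
  obtain M where M: "(g has_derivative M) (at (f z))" "\<forall>c v. M (c *\<^sub>C v) = c *\<^sub>C M v"
    by (elim exE conjE)
  show "\<exists>D. (g \<circ> f has_derivative D) (at z) \<and> (\<forall>c v. D (c *\<^sub>C v) = c *\<^sub>C D v)"
    using diff_chain_at[OF L(1) M(1)] L(2) M(2) by (intro exI[of _ "M \<circ> L"]) simp
qed

lemma scaleC_prod_simps [simp]: "fst (c *\<^sub>C x) = c *\<^sub>C fst x" "snd (c *\<^sub>C x) = c *\<^sub>C snd x"
  by (simp_all add: scaleC_prod_def)

lemma holomorphic_map_on_snd: "holomorphic_map_on snd S"
  unfolding holomorphic_map_on_def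
proof
  fix z :: "'a \<times> 'b"
  have "(snd has_derivative snd) (at z)"
    by (rule bounded_linear_imp_has_derivative[OF bounded_linear_snd])
  then show "\<exists>D. (snd has_derivative D) (at z) \<and> (\<forall>c v. D (c *\<^sub>C v) = c *\<^sub>C D v)"
    by (intro exI[of _ snd]) simp
qed

lemma ball_norm_sq_scaleC: "ball_norm_sq p (c *\<^sub>C a) = (cmod c)\<^sup>2 * ball_norm_sq p a"
  by (simp add: ball_norm_sq_def norm_scaleC hinner_scaleC_left norm_mult power_mult_distrib
      distrib_left)

section \<open>Automorphisms and congruence\<close>

lemma Aut_inverse:
  assumes "f \<in> Aut S"
  obtains g where "g \<in> Aut S" "\<And>z. z \<in> S \<Longrightarrow> g (f z) = z" "\<And>z. z \<in> S \<Longrightarrow> f (g z) = z"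
proof -
  from assms have f: "holomorphic_map_on f S" "f ` S \<subseteq> S"
    and "\<exists>g. holomorphic_map_on g S \<and> g ` S \<subseteq> S \<and> (\<forall>z\<in>S. g (f z) = z \<and> f (g z) = z)"
    unfolding Aut_def by simp_all
  then obtain g where g: "holomorphic_map_on g S" "g ` S \<subseteq> S" "\<forall>z\<in>S. g (f z) = z \<and> f (g z) = z"
    by (elim exE conjE)
  then have "g \<in> Aut S"
    unfolding Aut_def mem_Collect_eq using f by (intro conjI exI[of _ f]) simp_all
  then show ?thesis
    using that[of g] g(3) by simp
qed

lemma AutD:
  assumes "f \<in> Aut S"
  shows "holomorphic_map_on f S" "f ` S \<subseteq> S"
  using assms by (simp_all add: Aut_def)

lemma id_in_Aut: "id \<in> Aut S"
proof -
  have "holomorphic_map_on id S"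
    unfolding holomorphic_map_on_def id_def
    by (intro ballI exI[of _ "\<lambda>x. x"] conjI has_derivative_ident) simp
  then show ?thesis
    unfolding Aut_def by (auto intro!: exI[of _ id])
qed

lemma congruent_maps_refl: "congruent_maps F F"
  unfolding congruent_maps_def
  by (intro bexI[of _ id] ballI id_in_Aut) simp

text \<open>Both automorphisms are undone by their inverses. These invert only on the domain, hence
  the hypothesis on the range of \<open>G\<close>.\<close>

lemma congruent_maps_sym:
  assumes "congruent_maps F G" and "G ` disc \<subseteq> disc_times_ball"
  shows "congruent_maps G F"
proof -
  obtain \<phi> \<Psi> where \<phi>: "\<phi> \<in> Aut disc" and \<Psi>: "\<Psi> \<in> Aut disc_times_ball"
    and eq: "\<forall>z\<in>disc. F z = \<Psi> (G (\<phi> z))"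
    using assms(1) unfolding congruent_maps_def by (elim bexE)
  obtain \<psi> where \<psi>: "\<psi> \<in> Aut disc" "\<And>z. z \<in> disc \<Longrightarrow> \<phi> (\<psi> z) = z"
    using Aut_inverse[OF \<phi>] by metis
  obtain \<Theta> where \<Theta>: "\<Theta> \<in> Aut disc_times_ball" "\<And>x. x \<in> disc_times_ball \<Longrightarrow> \<Theta> (\<Psi> x) = x"
    using Aut_inverse[OF \<Psi>] by metis
  have "G z = \<Theta> (F (\<psi> z))" if z: "z \<in> disc" for z
  proof -
    have "\<psi> z \<in> disc"
      using AutD(2)[OF \<psi>(1)] z by blast
    then have "F (\<psi> z) = \<Psi> (G z)"
      using eq \<psi>(2)[OF z] by simp
    moreover have "G z \<in> disc_times_ball"
      using assms(2) z by blast
    ultimately show ?thesis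
      using \<Theta>(2) by simp
  qed
  then show ?thesis
    unfolding congruent_maps_def using \<psi>(1) \<Theta>(1) by blast
qed

text \<open>Schwarz--Pick for the inverse \<open>\<psi>\<close> bounds its derivative at
  \<open>\<phi> 0\<close> from above, and that derivative is the reciprocal of
  \<open>p\<close>.\<close>

lemma schwarz_pick_automorphism:
  assumes "\<phi> \<in> Aut disc" and "(\<phi> has_field_derivative p) (at 0)"
  shows "1 - (cmod (\<phi> 0))\<^sup>2 \<le> cmod p"
proof -
  obtain \<psi> where \<psi>: "\<psi> \<in> Aut disc" "\<And>z. z \<in> disc \<Longrightarrow> \<psi> (\<phi> z) = z"
    using Aut_inverse[OF assms(1)] by metis
  define z0 where "z0 = \<phi> 0"
  have z0: "cmod z0 < 1"
    using AutD(2)[OF assms(1)] by (auto simp: z0_def image_subset_iff)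
  have z0sq: "1 - (cmod z0)\<^sup>2 > 0"
    using one_minus_norm_sq_pos[OF z0] .
  obtain q where q: "(\<psi> has_derivative (\<lambda>h. h *\<^sub>C q)) (at z0)"
    using holomorphic_map_on_curve[OF AutD(1)[OF \<psi>(1)], of z0] z0 by auto
  then have q': "(\<psi> has_field_derivative q) (at z0)"
    unfolding has_field_derivative_def by (rule has_derivative_eq_rhs) (simp add: scaleC_complex_def fun_eq_iff)
  have "((\<lambda>\<zeta>. \<psi> (\<phi> \<zeta>)) has_field_derivative q * p) (at 0)"
    using DERIV_chain2[OF q'[unfolded z0_def] assms(2)] .
  then have "((\<lambda>\<zeta>. \<zeta>) has_field_derivative q * p) (at 0)"
    by (rule has_field_derivative_transform_within_open[of _ _ _ disc]) (use \<psi>(2) in auto)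
  then have qp: "q * p = 1"
    using DERIV_unique[OF _ DERIV_ident] by blast
  \<comment> \<open>The disc automorphism carrying 0 to \<open>z0\<close>, with derivative
    \<open>1 - (cmod z0)\<^sup>2\<close> at 0. It moves the base point of \<open>\<psi>\<close> to
    0, where \<open>schwarz_pick_ball\<close> applies.\<close>
  define m where "m = (\<lambda>\<zeta>. (\<zeta> + z0) / (1 + \<zeta> * cnj z0))"
  have m_ne: "1 + \<zeta> * cnj z0 \<noteq> 0" if "cmod \<zeta> < 1" for \<zeta>
  proof
    assume "1 + \<zeta> * cnj z0 = 0"
    then have "cmod (\<zeta> * cnj z0) = 1"
      by (metis add.inverse_unique norm_minus_cancel norm_one)
    moreover have "cmod \<zeta> * cmod z0 < 1 * 1"
      using that z0 by (intro mult_strict_mono') auto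
    ultimately show False
      by (simp add: norm_mult)
  qed
  have m_der: "(m has_field_derivative (1 - z0 * cnj z0) / (1 + \<zeta> * cnj z0)\<^sup>2) (at \<zeta>)"
    if "cmod \<zeta> < 1" for \<zeta>
  proof -
    have "(m has_field_derivative ((1 + 0) * (1 + \<zeta> * cnj z0) - (\<zeta> + z0) * (0 + 1 * cnj z0))
        / ((1 + \<zeta> * cnj z0) * (1 + \<zeta> * cnj z0))) (at \<zeta>)"
      unfolding m_def using m_ne[OF that]
      by (intro DERIV_divide DERIV_add DERIV_ident DERIV_const DERIV_cmult_right)
    then show ?thesis
      by (simp add: power2_eq_square algebra_simps)
  qed
  have m_hol: "holomorphic_map_on m disc"
    unfolding holomorphic_map_on_complex_iff[OF open_ball] holomorphic_on_open[OF open_ball]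
  proof
    fix \<zeta> :: complex assume "\<zeta> \<in> disc"
    then have "cmod \<zeta> < 1" by simp
    from m_der[OF this] show "\<exists>f'. (m has_field_derivative f') (at \<zeta>)" ..
  qed
  have m_disc: "m ` disc \<subseteq> disc"
  proof (rule image_subsetI)
    fix \<zeta> :: complex assume "\<zeta> \<in> disc"
    then have \<zeta>: "cmod \<zeta> < 1" by simp
    have "(cmod (1 + \<zeta> * cnj z0))\<^sup>2 - (cmod (\<zeta> + z0))\<^sup>2 = (1 - (cmod \<zeta>)\<^sup>2) * (1 - (cmod z0)\<^sup>2)"
      unfolding cmod_power2 by (simp add: power2_eq_square algebra_simps)
    also have "\<dots> > 0"
      using one_minus_norm_sq_pos[OF \<zeta>] z0sq by simp
    finally have "(cmod (\<zeta> + z0))\<^sup>2 < (cmod (1 + \<zeta> * cnj z0))\<^sup>2"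
      by simp
    then have "cmod (\<zeta> + z0) < cmod (1 + \<zeta> * cnj z0)"
      by (rule power2_less_imp_less) simp
    then show "m \<zeta> \<in> disc"
      using m_ne[OF \<zeta>] by (simp add: m_def norm_divide divide_less_eq)
  qed
  have "ball_norm_sq ((\<psi> \<circ> m) 0) (q * (1 - z0 * cnj z0)) \<le> 1"
  proof (rule schwarz_pick_ball)
    show "holomorphic_map_on (\<psi> \<circ> m) disc"
      using m_hol m_disc AutD(1)[OF \<psi>(1)] by (rule holomorphic_map_on_compose)
    show "(\<psi> \<circ> m) ` disc \<subseteq> disc"
      using m_disc AutD(2)[OF \<psi>(1)] by fastforce
    have "(m has_field_derivative (1 - z0 * cnj z0)) (at 0)"
      using m_der[of 0] by simp
    moreover have "(\<psi> has_field_derivative q) (at (m 0))"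
      using q' by (simp add: m_def)
    ultimately have "(\<psi> \<circ> m has_field_derivative q * (1 - z0 * cnj z0)) (at 0)"
      by (intro DERIV_chain)
    then show "(\<psi> \<circ> m has_derivative (\<lambda>h. h *\<^sub>C (q * (1 - z0 * cnj z0)))) (at 0)"
      unfolding has_field_derivative_def
      by (rule has_derivative_eq_rhs) (simp add: scaleC_complex_def fun_eq_iff)
  qed
  moreover have "(\<psi> \<circ> m) 0 = 0"
    using \<psi>(2)[of 0] by (simp add: m_def z0_def)
  moreover have "cmod (q * (1 - z0 * cnj z0)) = cmod q * (1 - (cmod z0)\<^sup>2)"
  proof -
    have "1 - z0 * cnj z0 = of_real (1 - (cmod z0)\<^sup>2)"
      by (simp only: of_real_diff of_real_1 complex_norm_square)
    then show ?thesis
      using z0sq by (simp only: norm_mult norm_of_real)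
  qed
  ultimately have "(cmod q * (1 - (cmod z0)\<^sup>2))\<^sup>2 \<le> 1"
    by (simp add: ball_norm_sq_complex)
  then have "cmod q * (1 - (cmod z0)\<^sup>2) \<le> 1"
    using z0sq by (simp add: abs_square_le_1 abs_mult)
  then have "cmod p * (cmod q * (1 - (cmod z0)\<^sup>2)) \<le> cmod p * 1"
    by (intro mult_left_mono) auto
  moreover have "cmod p * cmod q = 1"
    using arg_cong[OF qp, of cmod] by (simp add: norm_mult mult.commute)
  ultimately show ?thesis
    by (simp add: z0_def mult.assoc[symmetric])
qed

text \<open>The linear disc through the origin in direction \<open>(a, b)\<close> is a Kobayashi extremal disc, since
  \<open>norm a \<le> norm b\<close>. Automorphisms carry it to a disc tangent to the image of \<open>G\<close>, whose second
  component obeys the Schwarz--Pick inequality.\<close>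

lemma congruent_maps_norm_bound:
  fixes F G :: "complex \<Rightarrow> complex \<times> (complex ^ 'n)"
  assumes cong: "congruent_maps F G"
    and F0: "F 0 = 0" and dF: "(F has_derivative (\<lambda>h. h *\<^sub>C (a, b))) (at 0)"
    and ab: "norm a \<le> norm b" "b \<noteq> 0"
    and holG: "holomorphic_map_on G disc" and G: "G ` disc \<subseteq> disc_times_ball"
  obtains z b' where "z \<in> disc" "((\<lambda>z. snd (G z)) has_derivative (\<lambda>h. h *\<^sub>C b')) (at z)"
    "(1 - (cmod z)\<^sup>2)\<^sup>2 * ball_norm_sq (snd (G z)) b' \<le> (norm b)\<^sup>2"
proof -
  obtain \<phi> \<Psi> where \<phi>: "\<phi> \<in> Aut disc" and \<Psi>: "\<Psi> \<in> Aut disc_times_ball"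
    and eq: "\<forall>z\<in>disc. F z = \<Psi> (G (\<phi> z))"
    using cong unfolding congruent_maps_def by (elim bexE)
  obtain \<Theta> where \<Theta>: "\<Theta> \<in> Aut disc_times_ball" "\<And>x. x \<in> disc_times_ball \<Longrightarrow> \<Theta> (\<Psi> x) = x"
    using Aut_inverse[OF \<Psi>] by metis
  have \<phi>_disc: "\<phi> z \<in> disc" if "z \<in> disc" for z
    using AutD(2)[OF \<phi>] that by blast
  have \<Theta>F: "\<Theta> (F z) = G (\<phi> z)" if z: "z \<in> disc" for z
  proof -
    have "G (\<phi> z) \<in> disc_times_ball"
      using G \<phi>_disc[OF z] by blast
    then show ?thesis
      using eq z \<Theta>(2) by simp
  qed
  define z0 where "z0 = \<phi> 0"
  have z0: "z0 \<in> disc"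
    unfolding z0_def by (rule \<phi>_disc) simp
  obtain d where d: "(G has_derivative (\<lambda>h. h *\<^sub>C d)) (at z0)"
    using holomorphic_map_on_curve[OF holG z0] .
  obtain p where p: "(\<phi> has_derivative (\<lambda>h. h *\<^sub>C p)) (at 0)"
    using holomorphic_map_on_curve[OF AutD(1)[OF \<phi>], of 0] by auto
  have "(0 :: complex \<times> (complex ^ 'n)) \<in> disc_times_ball"
    by (simp add: zero_prod_def)
  from bspec[OF AutD(1)[OF \<Theta>(1), unfolded holomorphic_map_on_def] this]
  obtain L where L: "(\<Theta> has_derivative L) (at 0)" and L_scale: "\<And>c v. L (c *\<^sub>C v) = c *\<^sub>C L v"
    by auto
  \<comment> \<open>\<open>G \<circ> \<phi>\<close> agrees with \<open>\<Theta> \<circ> F\<close> on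
    the disc; comparing derivatives at 0 shows how \<open>L\<close> acts on the direction
    \<open>(a, b)\<close>.\<close>
  have "(G \<circ> \<phi> has_derivative (\<lambda>h. (h *\<^sub>C p) *\<^sub>C d)) (at 0)"
    using diff_chain_at[OF p d[unfolded z0_def]] by (simp add: o_def)
  moreover have "(\<Theta> \<circ> F has_derivative (\<lambda>h. L (h *\<^sub>C (a, b)))) (at 0)"
    using diff_chain_at[OF dF, of \<Theta> L] L F0 by (simp add: o_def)
  then have "(G \<circ> \<phi> has_derivative (\<lambda>h. L (h *\<^sub>C (a, b)))) (at 0)"
    by (rule has_derivative_transform_within_open[of _ _ _ _ disc]) (use \<Theta>F in auto)
  ultimately have L_eq: "L (h *\<^sub>C (a, b)) = (h * p) *\<^sub>C d" for h
    by (metis (no_types, lifting) has_derivative_unique scaleC_complex_def)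
  \<comment> \<open>Dividing by \<open>norm b\<close> makes the second component of \<open>v\<close>
    a unit vector. As \<open>norm a \<le> norm b\<close>, the first has norm at most 1, so the
    linear disc \<open>e\<close> stays in the product.\<close>
  define v where "v = complex_of_real (1 / norm b) *\<^sub>C (a, b)"
  define e where "e = (\<lambda>\<zeta>. \<zeta> *\<^sub>C v)"
  have e_der: "(e has_derivative (\<lambda>h. h *\<^sub>C v)) (at \<zeta>)" for \<zeta>
    unfolding e_def by (rule bounded_linear_imp_has_derivative[OF bounded_linear_scaleC_left])
  have e_hol: "holomorphic_map_on e disc"
    using e_der by (intro holomorphic_map_on_curveI) blast
  have e_sub: "e ` disc \<subseteq> disc_times_ball"
  proof (rule image_subsetI)
    fix \<zeta> :: complex assume "\<zeta> \<in> disc"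
    then have \<zeta>: "cmod \<zeta> < 1" by simp
    have v: "norm (fst v) \<le> 1" "norm (snd v) \<le> 1"
      using ab by (simp_all add: v_def norm_scaleC norm_divide)
    have "cmod \<zeta> * norm (fst v) \<le> cmod \<zeta> * 1" "cmod \<zeta> * norm (snd v) \<le> cmod \<zeta> * 1"
      using v by (intro mult_left_mono; simp)+
    then show "e \<zeta> \<in> disc_times_ball"
      using \<zeta> by (simp add: e_def mem_Times_iff norm_scaleC)
  qed
  define g where "g = snd \<circ> (\<Theta> \<circ> e)"
  have \<Theta>e: "holomorphic_map_on (\<Theta> \<circ> e) disc"
    using e_hol e_sub AutD(1)[OF \<Theta>(1)] by (rule holomorphic_map_on_compose)
  have \<Theta>e_sub: "(\<Theta> \<circ> e) ` disc \<subseteq> disc_times_ball"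
    using e_sub AutD(2)[OF \<Theta>(1)] by (simp add: image_comp[symmetric]) blast
  define u where "u = (p / of_real (norm b)) *\<^sub>C snd d"
  have "ball_norm_sq (g 0) u \<le> 1"
  proof (rule schwarz_pick_ball)
    show "holomorphic_map_on g disc"
      unfolding g_def using \<Theta>e subset_UNIV holomorphic_map_on_snd by (rule holomorphic_map_on_compose)
    show "g ` disc \<subseteq> ball 0 1"
      using \<Theta>e_sub by (auto simp: g_def image_subset_iff mem_Times_iff)
    have "(\<Theta> \<circ> e has_derivative L \<circ> (\<lambda>h. h *\<^sub>C v)) (at 0)"
      using L by (intro diff_chain_at e_der) (simp add: e_def)
    then have "(g has_derivative snd \<circ> (L \<circ> (\<lambda>h. h *\<^sub>C v))) (at 0)"
      unfolding g_def by (rule diff_chain_at) (rule bounded_linear_imp_has_derivative[OF bounded_linear_snd])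
    then show "(g has_derivative (\<lambda>h. h *\<^sub>C u)) (at 0)"
    proof (rule has_derivative_eq_rhs)
      have "L (h *\<^sub>C v) = (h * (1 / norm b) * p) *\<^sub>C d" for h
        unfolding v_def scaleC_scaleC L_eq by simp
      then show "snd \<circ> (L \<circ> (\<lambda>h. h *\<^sub>C v)) = (\<lambda>h. h *\<^sub>C u)"
        by (simp add: fun_eq_iff u_def scaleC_scaleC)
    qed
  qed
  moreover have "g 0 = snd (G z0)"
    using \<Theta>F[of 0] F0 by (simp add: g_def e_def z0_def)
  ultimately have "(cmod p)\<^sup>2 * ball_norm_sq (snd (G z0)) (snd d) \<le> (norm b)\<^sup>2"
    using ab by (simp add: u_def ball_norm_sq_scaleC norm_divide power_divide divide_le_eq)
  \<comment> \<open>The reparametrisation \<open>\<phi>\<close> enters the estimate through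
    \<open>cmod p\<close>, which \<open>schwarz_pick_automorphism\<close> bounds from below.\<close>
  moreover have "(1 - (cmod z0)\<^sup>2)\<^sup>2 * ball_norm_sq (snd (G z0)) (snd d)
      \<le> (cmod p)\<^sup>2 * ball_norm_sq (snd (G z0)) (snd d)"
  proof (rule mult_right_mono)
    have "(\<phi> has_field_derivative p) (at 0)"
      using p unfolding has_field_derivative_def
      by (rule has_derivative_eq_rhs) (simp add: scaleC_complex_def fun_eq_iff)
    then have "1 - (cmod z0)\<^sup>2 \<le> cmod p"
      unfolding z0_def by (rule schwarz_pick_automorphism[OF \<phi>])
    then show "(1 - (cmod z0)\<^sup>2)\<^sup>2 \<le> (cmod p)\<^sup>2"
      using z0 one_minus_norm_sq_pos[of z0] by (intro power_mono) auto
    have "norm (snd (G z0)) < 1"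
      using G z0 by (auto simp: image_subset_iff mem_Times_iff)
    then show "0 \<le> ball_norm_sq (snd (G z0)) (snd d)"
      using one_minus_norm_sq_pos[of "snd (G z0)"] by (simp add: ball_norm_sq_def)
  qed
  moreover have "((\<lambda>z. snd (G z)) has_derivative (\<lambda>h. h *\<^sub>C snd d)) (at z0)"
    using has_derivative_snd[OF d] by simp
  ultimately show ?thesis
    using z0 by (intro that) auto
qed

section \<open>Inverse branches of cubic rational functions\<close>

text \<open>With \<open>u = w\<^sup>2\<close> this becomes the contraction bound for the inverse of
  \<open>R\<close>: the polynomial on the right is the numerator of the derivative of
  \<open>R\<close>, and \<open>N\<close> is \<open>1 - (norm (V w))\<^sup>2\<close> cleared of its
  denominator.\<close>

lemma cubic_estimate:
  fixes c :: real and u :: complex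
  assumes c: "0 < c" "c < 1/3"
  defines "N \<equiv> (cmod (of_real c + u))\<^sup>2 - (1 - c\<^sup>2) * (cmod u + (cmod u)\<^sup>2)"
  assumes N: "0 < N"
  shows "N \<le> c * cmod (of_real c * u\<^sup>2 + of_real (3 * c\<^sup>2 - 1) * u + of_real c)"
proof (cases "u = 0")
  case True
  then show ?thesis
    using c by (simp add: N_def power2_eq_square)
next
  case False
  define s x y where "s = cmod u" and "x = Re u" and "y = Im u"
  have s: "s > 0" and s2: "s\<^sup>2 = x\<^sup>2 + y\<^sup>2" and xs: "\<bar>x\<bar> \<le> s"
    using False abs_Re_le_cmod[of u] by (auto simp: s_def x_def y_def cmod_power2)
  txt \<open>With \<open>x\<close> and \<open>s\<close> fixed, the difference of squares \<open>E q\<close> is affine and nondecreasing in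
    \<open>q = 1 + s\<^sup>2\<close>. It is nonnegative at the value \<open>q0 \<le> q\<close> at which \<open>N\<close> would vanish.\<close>
  define k where "k = 1 - 3 * c\<^sup>2"
  define M where "M = (\<lambda>q. c\<^sup>2 * (q\<^sup>2 - 4 * s\<^sup>2 + 4 * x\<^sup>2) - 2 * k * c * x * q + k\<^sup>2 * s\<^sup>2)"
  define E where "E = (\<lambda>q. c\<^sup>2 * M q - (c\<^sup>2 * q + 2 * c * x - (1 - c\<^sup>2) * s)\<^sup>2)"
  define q q0 where "q = 1 + s\<^sup>2" and "q0 = ((1 - c\<^sup>2) * s - 2 * c * x) / c\<^sup>2"
  have N_eq: "N = c\<^sup>2 * q + 2 * c * x - (1 - c\<^sup>2) * s"
  proof -
    have "(cmod (of_real c + u))\<^sup>2 = c\<^sup>2 + 2 * c * x + s\<^sup>2"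
      unfolding cmod_power2 s2 by (simp add: x_def y_def power2_eq_square algebra_simps)
    then show ?thesis
      unfolding N_def s_def[symmetric] q_def by (simp add: algebra_simps)
  qed
  have M_eq: "(cmod (of_real c * u\<^sup>2 + of_real (3 * c\<^sup>2 - 1) * u + of_real c))\<^sup>2 = M q"
  proof -
    have "of_real c * u\<^sup>2 + of_real (3 * c\<^sup>2 - 1) * u + of_real c
      = Complex (c * (x\<^sup>2 - y\<^sup>2) - k * x + c) (c * (2 * x * y) - k * y)"
      by (simp add: complex_eq_iff x_def y_def k_def power2_eq_square algebra_simps)
    then have "(cmod (of_real c * u\<^sup>2 + of_real (3 * c\<^sup>2 - 1) * u + of_real c))\<^sup>2
      = (c * (x\<^sup>2 - y\<^sup>2) - k * x + c)\<^sup>2 + (c * (2 * x * y) - k * y)\<^sup>2"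
      by (simp add: cmod_power2)
    also have "\<dots> = M q"
      unfolding M_def q_def s2 by (simp add: power2_eq_square algebra_simps)
    finally show ?thesis .
  qed
  have "0 \<le> E q0"
  proof -
    \<comment> \<open>Here \<open>c < 1/3\<close> enters. The bound makes the term with
      \<open>y\<^sup>2\<close> nonnegative when \<open>s\<^sup>2 * M q0\<close> is split into two
      summands below.\<close>
    have "2 * s \<le> q0"
    proof -
      have "2 * c * x \<le> 2 * c * s"
        using c xs by simp
      moreover have "0 \<le> (1 - 3 * c) * (1 + c) * s"
        using c s by simp
      moreover have "(1 - c\<^sup>2) * s - 2 * c * s - 2 * s * c\<^sup>2 = (1 - 3 * c) * (1 + c) * s"
        by (simp add: power2_eq_square algebra_simps)
      ultimately have "2 * s * c\<^sup>2 \<le> (1 - c\<^sup>2) * s - 2 * c * x"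
        by linarith
      then show ?thesis
        using c by (simp add: q0_def pos_le_divide_eq)
    qed
    then have "(2 * s)\<^sup>2 \<le> q0\<^sup>2"
      using s by (intro power_mono) auto
    then have "0 \<le> (c * q0 * x - k * s\<^sup>2)\<^sup>2 + c\<^sup>2 * (q0\<^sup>2 - 4 * s\<^sup>2) * y\<^sup>2"
      by (simp add: power_mult_distrib)
    also have "\<dots> = s\<^sup>2 * M q0"
      unfolding M_def s2 by (simp add: power2_eq_square algebra_simps)
    finally have "0 \<le> M q0"
      using s by (simp add: zero_le_mult_iff)
    moreover have "c\<^sup>2 * q0 = (1 - c\<^sup>2) * s - 2 * c * x"
      using c by (simp add: q0_def)
    ultimately show ?thesis
      by (simp add: E_def)
  qed
  also have "E q0 \<le> E q"
  proof -
    \<comment> \<open>The quadratic terms cancel because \<open>M\<close> is multiplied by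
      \<open>c\<^sup>2\<close>. The sign of the slope is that of \<open>s - 3 * c * x\<close>, where
      \<open>c < 1/3\<close> enters again.\<close>
    have "E q - E q0 = 2 * c\<^sup>2 * (1 - c\<^sup>2) * (s - 3 * c * x) * (q - q0)"
      unfolding E_def M_def k_def by (simp add: power2_eq_square algebra_simps)
    moreover have "3 * c * x \<le> s"
    proof -
      have "3 * c * x \<le> 3 * c * s"
        using c xs by simp
      also have "\<dots> \<le> s"
        using c s by simp
      finally show ?thesis .
    qed
    moreover have "c\<^sup>2 < 1"
      using c by (simp add: abs_square_less_1)
    moreover have "q0 \<le> q"
      using N c unfolding N_eq q0_def by (simp add: field_simps)
    ultimately show ?thesis
      using c by (smt (verit) mult_nonneg_nonneg zero_le_power2)
  qed
  finally have "N\<^sup>2 \<le> c\<^sup>2 * M q"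
    unfolding E_def N_eq by simp
  then have "N\<^sup>2 \<le> (c * cmod (of_real c * u\<^sup>2 + of_real (3 * c\<^sup>2 - 1) * u + of_real c))\<^sup>2"
    unfolding M_eq[symmetric] by (simp only: power_mult_distrib)
  then show ?thesis
    by (rule power2_le_imp_le) (use c in simp)
qed

section \<open>The maps \<open>R\<close> and \<open>V\<close>, and the bijection of \<open>D\<close>
  onto the disc\<close>

locale cubic_isometry =
  fixes c :: real and e1 e2 :: "'a::{real_inner,complex_normed_vector}"
  assumes c_pos: "0 < c" and c_less: "c < 1/3"
    and hinner_e: "hinner e1 e1 = 1" "hinner e2 e2 = 1" "hinner e1 e2 = 0"
begin

definition "numer w = w * (1 + of_real c * w\<^sup>2)" for w :: complex
definition "denom w = of_real c + w\<^sup>2" for w :: complex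
definition "R w = numer w / denom w" for w :: complex
definition "k w = of_real (sqrt (1 - c\<^sup>2)) * w / denom w" for w :: complex
definition "V w = k w *\<^sub>C e1 + (k w * w) *\<^sub>C e2" for w :: complex
text \<open>Stated without division: at the zeros of \<open>denom\<close> the quotient
  \<open>R\<close> has the default value 0 and would pass the test
  \<open>cmod (R w) < 1\<close>.\<close>

definition "D = {w \<in> disc. cmod (numer w) < cmod (denom w)}"

lemma c_sq: "c\<^sup>2 < 1"
  using c_pos c_less by (simp add: abs_square_less_1)

lemma hinner_V: "hinner (V w) (V v) = k w * cnj (k v) * (1 + w * cnj v)"
proof -
  have "hinner e2 e1 = 0"
    using hinner_commute[of e2 e1] hinner_e by simp
  then show ?thesis
    by (simp add: V_def hinner_add_left hinner_add_right hinner_scaleC_left hinner_scaleC_right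
        hinner_e algebra_simps)
qed

text \<open>Cleared of denominators, this is a polynomial identity in \<open>w\<close> and
  \<open>cnj v\<close>. The factor \<open>1 - w * cnj v\<close> reflects the symmetry
  \<open>R (1 / w) = 1 / R w\<close>, and \<open>V\<close> is chosen so that its Hermitian products
  supply the cofactor.\<close>

lemma polarized_identity:
  assumes "denom w \<noteq> 0" "denom v \<noteq> 0"
  shows "1 - R w * cnj (R v) = (1 - w * cnj v) * (1 - hinner (V w) (V v))"
proof -
  have "of_real (sqrt (1 - c\<^sup>2)) * of_real (sqrt (1 - c\<^sup>2)) = complex_of_real (1 - c\<^sup>2)"
    using c_sq by (simp flip: of_real_mult)
  then have kk: "k w * cnj (k v) = of_real (1 - c\<^sup>2) * w * cnj v / (denom w * cnj (denom v))"
    by (simp add: k_def mult_ac)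
  define A B where "A = denom w" and "B = cnj (denom v)"
  have AB: "A \<noteq> 0" "B \<noteq> 0"
    using assms by (auto simp: A_def B_def)
  have "A * B - numer w * cnj (numer v) =
    (1 - w * cnj v) * (A * B - of_real (1 - c\<^sup>2) * w * cnj v * (1 + w * cnj v))"
    unfolding A_def B_def numer_def denom_def by (simp add: power2_eq_square algebra_simps)
  then have "(A * B - numer w * cnj (numer v)) / (A * B) =
    (1 - w * cnj v) * ((A * B - of_real (1 - c\<^sup>2) * w * cnj v * (1 + w * cnj v)) / (A * B))"
    by simp
  then show ?thesis
    using AB unfolding hinner_V kk R_def A_def[symmetric] B_def[symmetric] complex_cnj_divide
    by (simp add: diff_divide_distrib)
qed

lemma potential_identity:
  assumes "denom w \<noteq> 0"
  shows "1 - (cmod (R w))\<^sup>2 = (1 - (cmod w)\<^sup>2) * (1 - (norm (V w))\<^sup>2)"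
proof -
  have "complex_of_real (1 - (cmod (R w))\<^sup>2) = of_real ((1 - (cmod w)\<^sup>2) * (1 - (norm (V w))\<^sup>2))"
    using polarized_identity[OF assms assms]
    by (simp only: of_real_diff of_real_mult of_real_1 complex_norm_square hinner_self[symmetric])
  then show ?thesis
    by (simp only: of_real_eq_iff)
qed

text \<open>The bound on \<open>V w\<close> follows from \<open>potential_identity\<close>: the
  product is positive and so is its first factor.\<close>

lemma D_facts:
  assumes "w \<in> D"
  shows "denom w \<noteq> 0" "cmod w < 1" "cmod (R w) < 1" "norm (V w) < 1"
proof -
  show denom: "denom w \<noteq> 0" and w: "cmod w < 1" and R: "cmod (R w) < 1"
    using assms by (auto simp: D_def R_def norm_divide divide_less_eq)
  have "0 < (1 - (cmod w)\<^sup>2) * (1 - (norm (V w))\<^sup>2)"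
    using potential_identity[OF denom] one_minus_norm_sq_pos[OF R] by simp
  then have "(norm (V w))\<^sup>2 < 1"
    using one_minus_norm_sq_pos[OF w] by (simp add: zero_less_mult_iff)
  then show "norm (V w) < 1"
    by (simp add: abs_square_less_1)
qed

text \<open>Reverse Cauchy--Schwarz in both factors: equality in the first one forces the points to agree.\<close>

lemma inj_on_R: "inj_on R D"
proof (rule inj_onI)
  fix w v assume wv: "w \<in> D" "v \<in> D" and eq: "R w = R v"
  note W = D_facts[OF wv(1)] and V = D_facts[OF wv(2)]
  define a b p q where "a = 1 - (cmod w)\<^sup>2" and "b = 1 - (cmod v)\<^sup>2"
    and "p = 1 - (norm (V w))\<^sup>2" and "q = 1 - (norm (V v))\<^sup>2"
  have pos: "a > 0" "b > 0" "p > 0" "q > 0"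
    using W V one_minus_norm_sq_pos by (auto simp: a_def b_def p_def q_def)
  \<comment> \<open>Since \<open>R w = R v\<close>, the mixed terms have the same product as the
    diagonal ones, which leaves no room for the excess \<open>b * (cmod (w - v))\<^sup>2\<close> in
    the first factor.\<close>
  have "(cmod (1 - w * cnj v))\<^sup>2 * (cmod (1 - hinner (V w) (V v)))\<^sup>2
      = (cmod (1 - R w * cnj (R w)))\<^sup>2"
    using polarized_identity[OF W(1) V(1)] eq by (simp add: norm_mult power_mult_distrib)
  also have "1 - R w * cnj (R w) = of_real (1 - (cmod (R w))\<^sup>2)"
    by (simp only: of_real_diff of_real_1 complex_norm_square)
  also have "(cmod (of_real (1 - (cmod (R w))\<^sup>2)))\<^sup>2 = (1 - (cmod (R w))\<^sup>2) * (1 - (cmod (R v))\<^sup>2)"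
    unfolding norm_of_real power2_abs by (simp add: eq power2_eq_square)
  also have "\<dots> = (a * b) * (p * q)"
    unfolding potential_identity[OF W(1)] potential_identity[OF V(1)] by (simp add: a_def b_def p_def q_def)
  finally have *: "(cmod (1 - w * cnj v))\<^sup>2 * (cmod (1 - hinner (V w) (V v)))\<^sup>2 = (a * b) * (p * q)" .
  have "p * q \<le> (cmod (1 - hinner (V w) (V v)))\<^sup>2"
    using hinner_gram_identity[of "V w" "V v"] pos unfolding p_def[symmetric] q_def[symmetric] by simp
  moreover have "b * (cmod (w - v))\<^sup>2 + a * b \<le> (cmod (1 - w * cnj v))\<^sup>2"
    using hinner_gram_identity[of w v] pos unfolding a_def[symmetric] b_def[symmetric]
    by (simp add: hinner_complex)
  ultimately have "(b * (cmod (w - v))\<^sup>2 + a * b) * (p * q)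
      \<le> (cmod (1 - w * cnj v))\<^sup>2 * (cmod (1 - hinner (V w) (V v)))\<^sup>2"
    using pos by (intro mult_mono) auto
  then have "(b * (cmod (w - v))\<^sup>2) * (p * q) \<le> 0"
    unfolding * by (simp add: distrib_right)
  then have "b * (cmod (w - v))\<^sup>2 \<le> 0"
    using pos by (simp add: mult_le_0_iff)
  then have "(cmod (w - v))\<^sup>2 \<le> 0"
    using pos by (simp add: mult_le_0_iff)
  then show "w = v"
    by simp
qed

text \<open>\<open>R w\<close> is \<open>w\<close> divided by a function \<open>?\<beta>\<close>
  that maps the closed disc into itself, so a solution of \<open>R w = z\<close> is a fixed point of
  \<open>z * ?\<beta> w\<close>.\<close>

lemma surj_R:
  assumes "z \<in> disc"
  shows "\<exists>w\<in>D. R w = z"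
proof -
  have z: "cmod z < 1"
    using assms by simp
  have ne: "1 + of_real c * w\<^sup>2 \<noteq> 0" if "cmod w \<le> 1" for w :: complex
  proof
    assume "1 + of_real c * w\<^sup>2 = 0"
    then have "of_real c * w\<^sup>2 = - 1"
      by (simp add: eq_neg_iff_add_eq_0 add.commute)
    then have "c * (cmod w)\<^sup>2 = 1"
      using c_pos by (metis abs_of_pos norm_minus_cancel norm_mult norm_of_real norm_one norm_power)
    moreover have "c * (cmod w)\<^sup>2 \<le> c * 1"
      using that c_pos by (intro mult_left_mono) (auto simp: abs_square_le_1)
    ultimately show False
      using c_less by simp
  qed
  \<comment> \<open>A disc automorphism with real parameter \<open>c\<close>, evaluated at
    \<open>w\<^sup>2\<close>.\<close>
  let ?\<beta> = "\<lambda>w. denom w / (1 + of_real c * w\<^sup>2)"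
  have \<beta>: "cmod (?\<beta> w) \<le> 1" if w: "cmod w \<le> 1" for w
  proof -
    define r where "r = (cmod (w\<^sup>2))\<^sup>2"
    have r: "r \<le> 1"
      using w by (simp add: r_def norm_power power_le_one)
    have "(cmod (1 + of_real c * u))\<^sup>2 - (cmod (of_real c + u))\<^sup>2 = (1 - c\<^sup>2) * (1 - (cmod u)\<^sup>2)" for u
      unfolding cmod_power2 by (simp add: power2_eq_square algebra_simps)
    from this[of "w\<^sup>2"] have "(cmod (denom w))\<^sup>2 \<le> (cmod (1 + of_real c * w\<^sup>2))\<^sup>2"
      using c_sq r unfolding denom_def r_def[symmetric] by (smt (verit) mult_nonneg_nonneg)
    then have "cmod (denom w) \<le> cmod (1 + of_real c * w\<^sup>2)"
      by (rule power2_le_imp_le) simp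
    then show ?thesis
      by (simp add: norm_divide divide_le_eq_1)
  qed
  have cont: "continuous_on (cball 0 1) (\<lambda>w. z * ?\<beta> w)"
    unfolding denom_def using ne by (intro continuous_intros) auto
  have "(\<lambda>w. z * ?\<beta> w) \<in> cball 0 1 \<rightarrow> cball 0 1"
  proof
    fix w :: complex assume "w \<in> cball 0 1"
    then have "cmod z * cmod (?\<beta> w) \<le> 1 * 1"
      using z \<beta>[of w] by (intro mult_mono) auto
    then show "z * ?\<beta> w \<in> cball 0 1"
      by (simp add: norm_mult norm_divide)
  qed
  then obtain w where w: "cmod w \<le> 1" and fixpoint: "z * ?\<beta> w = w"
    using brouwer[OF compact_cball convex_cball _ cont] by auto
  \<comment> \<open>Brouwer only places the fixed point in the closed disc; the factor
    \<open>z\<close> moves it strictly inside.\<close>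
  have "cmod w = cmod z * cmod (?\<beta> w)"
    using fixpoint by (metis norm_mult)
  also have "\<dots> \<le> cmod z * 1"
    using \<beta>[OF w] by (intro mult_left_mono) auto
  finally have w1: "cmod w < 1"
    using z by simp
  have eq: "numer w = z * denom w"
    using fixpoint ne[OF w] by (simp add: numer_def field_simps)
  \<comment> \<open>At a zero of \<open>denom\<close> the fixed point equation would force
    \<open>w = 0\<close>, but \<open>denom 0 = c\<close>.\<close>
  have denom: "denom w \<noteq> 0"
  proof
    assume "denom w = 0"
    then have "w = 0"
      using eq ne[OF w] by (simp add: numer_def)
    with \<open>denom w = 0\<close> show False
      using c_pos by (simp add: denom_def)
  qed
  then have "cmod (numer w) < cmod (denom w)"
    using eq z by (simp add: norm_mult)
  with w1 have "w \<in> D"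
    by (simp add: D_def)
  moreover have "R w = z"
    using eq denom by (simp add: R_def)
  ultimately show ?thesis ..
qed

lemma image_R: "R ` D = disc"
  using surj_R D_facts(3) by force

lemma zero_in_D: "0 \<in> D" and R_zero: "R 0 = 0" and V_zero: "V 0 = 0"
  using c_pos by (simp_all add: D_def numer_def denom_def R_def V_def k_def)

text \<open>The numerator is arranged as a quadratic in \<open>w\<^sup>2\<close> to match
  \<open>cubic_estimate\<close>.\<close>

lemma R_deriv:
  assumes "denom w \<noteq> 0"
  shows "(R has_field_derivative
    (of_real c * (w\<^sup>2)\<^sup>2 + of_real (3 * c\<^sup>2 - 1) * w\<^sup>2 + of_real c) / (denom w)\<^sup>2) (at w)"
proof -
  have "(numer has_field_derivative 1 + 3 * of_real c * w\<^sup>2) (at w)"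
    unfolding numer_def by (auto intro!: derivative_eq_intros simp: power2_eq_square algebra_simps)
  moreover have "(denom has_field_derivative 2 * w) (at w)"
    unfolding denom_def by (auto intro!: derivative_eq_intros)
  ultimately have "(R has_field_derivative
      ((1 + 3 * of_real c * w\<^sup>2) * denom w - numer w * (2 * w)) / (denom w * denom w)) (at w)"
    unfolding R_def using assms by (rule DERIV_divide)
  moreover have "(1 + 3 * of_real c * w\<^sup>2) * denom w - numer w * (2 * w)
      = of_real c * (w\<^sup>2)\<^sup>2 + of_real (3 * c\<^sup>2 - 1) * w\<^sup>2 + of_real c"
    by (simp add: numer_def denom_def power2_eq_square algebra_simps)
  ultimately show ?thesis
    by (simp add: power2_eq_square[of "denom w"])
qed

lemma open_D: "open D"
proof -
  have "D = disc \<inter> {w. cmod (numer w) < cmod (denom w)}"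
    by (auto simp: D_def)
  moreover have "open {w. cmod (numer w) < cmod (denom w)}"
    unfolding numer_def denom_def by (intro open_Collect_less continuous_intros)
  ultimately show ?thesis
    by auto
qed

section \<open>The inverse branch \<open>f1\<close> and the second component
  \<open>f2\<close>\<close>

definition f1 :: "complex \<Rightarrow> complex" where "f1 = inv_into D R"
definition f2 :: "complex \<Rightarrow> 'a" where "f2 z = V (f1 z)"

lemma f1_in_D: "z \<in> disc \<Longrightarrow> f1 z \<in> D" and R_f1: "z \<in> disc \<Longrightarrow> R (f1 z) = z"
  unfolding f1_def image_R[symmetric] by (auto intro: inv_into_into f_inv_into_f)

text \<open>An injective holomorphic function has a holomorphic inverse with reciprocal derivative.
  In the multiplied form, \<open>denom (f1 z) \<noteq> 0\<close> shows that the other side does not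
  vanish either.\<close>

lemma f1_deriv:
  assumes z: "z \<in> disc"
  obtains a where "(f1 has_field_derivative a) (at z)"
    "a * (of_real c * ((f1 z)\<^sup>2)\<^sup>2 + of_real (3 * c\<^sup>2 - 1) * (f1 z)\<^sup>2 + of_real c) = (denom (f1 z))\<^sup>2"
proof -
  have holR: "R holomorphic_on D"
    unfolding holomorphic_on_open[OF open_D] using R_deriv D_facts(1) by blast
  obtain g where g: "g holomorphic_on disc"
      "\<And>w. w \<in> D \<Longrightarrow> deriv R w * deriv g (R w) = 1" "\<And>w. w \<in> D \<Longrightarrow> g (R w) = w"
    using holomorphic_has_inverse[OF holR open_D inj_on_R] unfolding image_R by metis
  note w = f1_in_D[OF z] and denom = D_facts(1)[OF f1_in_D[OF z]]
  have "(g has_field_derivative deriv g z) (at z)"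
    using g(1) z by (simp add: holomorphic_derivI)
  then have "(f1 has_field_derivative deriv g z) (at z)"
    by (rule has_field_derivative_transform_within_open[of _ _ _ disc])
      (use z g(3) f1_in_D R_f1 in \<open>auto, metis\<close>)
  moreover have "deriv g z * (of_real c * ((f1 z)\<^sup>2)\<^sup>2 + of_real (3 * c\<^sup>2 - 1) * (f1 z)\<^sup>2 + of_real c)
      = (denom (f1 z))\<^sup>2"
    using g(2)[OF w] denom unfolding R_f1[OF z] DERIV_imp_deriv[OF R_deriv[OF denom]]
    by (simp add: field_simps)
  ultimately show ?thesis ..
qed

lemma f2_deriv:
  assumes z: "z \<in> disc"
  obtains b where "(f2 has_derivative (\<lambda>h. h *\<^sub>C b)) (at z)"
proof -
  note w = f1_in_D[OF z] and denom = D_facts(1)[OF f1_in_D[OF z]]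
  obtain a where a: "(f1 has_field_derivative a) (at z)"
    using f1_deriv[OF z] .
  have "((\<lambda>z. k (f1 z)) has_field_derivative
      ((of_real (sqrt (1 - c\<^sup>2)) * a) * denom (f1 z)
        - of_real (sqrt (1 - c\<^sup>2)) * f1 z * (0 + of_nat 2 * (a * f1 z ^ (2 - Suc 0)))) / (denom (f1 z) * denom (f1 z))) (at z)"
    using denom unfolding k_def denom_def
    by (intro DERIV_divide DERIV_cmult a DERIV_add DERIV_const DERIV_power)
  then obtain d where d: "((\<lambda>z. k (f1 z)) has_field_derivative d) (at z)"
    by blast
  note d' = DERIV_mult[OF d a]
  let ?d' = "d * f1 z + a * k (f1 z)"
  have "(f2 has_derivative (\<lambda>h. (d * h) *\<^sub>C e1 + (?d' * h) *\<^sub>C e2)) (at z)"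
    unfolding f2_def V_def
    by (intro has_derivative_add bounded_linear.has_derivative[OF bounded_linear_scaleC_left]
        has_field_derivative_imp_has_derivative d d')
  then have "(f2 has_derivative (\<lambda>h. h *\<^sub>C (d *\<^sub>C e1 + ?d' *\<^sub>C e2))) (at z)"
    by (simp add: scaleC_add_right scaleC_scaleC mult.commute)
  then show ?thesis ..
qed

text \<open>The left-hand side is the share of the disc metric at \<open>z\<close> carried by
  \<open>f1\<close>. By \<open>potential_identity\<close> it equals the square of
  \<open>1 - (norm (f2 z))\<^sup>2\<close> times \<open>cmod a\<close>, which
  \<open>cubic_estimate\<close> controls.\<close>

lemma f1_contraction:
  assumes z: "z \<in> disc" and a: "(f1 has_field_derivative a) (at z)"
  shows "(1 - (cmod z)\<^sup>2)\<^sup>2 * ball_norm_sq (f1 z) a \<le> c\<^sup>2"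
proof -
  define w where "w = f1 z"
  have wD: "w \<in> D"
    using f1_in_D[OF z] by (simp add: w_def)
  note W = D_facts[OF wD]
  define Q where "Q = of_real c * (w\<^sup>2)\<^sup>2 + of_real (3 * c\<^sup>2 - 1) * w\<^sup>2 + of_real c"
  have aQ: "a * Q = (denom w)\<^sup>2"
    using f1_deriv[OF z] DERIV_unique[OF a] unfolding Q_def w_def by metis
  define p where "p = 1 - (norm (V w))\<^sup>2"
  have p: "p > 0"
    using one_minus_norm_sq_pos[OF W(4)] by (simp add: p_def)
  \<comment> \<open>This matches the left-hand side of \<open>cubic_estimate\<close> at
    \<open>u = w\<^sup>2\<close>; its positivity there amounts to \<open>V w\<close> lying in the
    ball.\<close>
  define N where "N = (cmod (of_real c + w\<^sup>2))\<^sup>2 - (1 - c\<^sup>2) * (cmod (w\<^sup>2) + (cmod (w\<^sup>2))\<^sup>2)"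
  have N: "N = p * (cmod (denom w))\<^sup>2"
  proof -
    have "(norm (V w))\<^sup>2 = (cmod (k w))\<^sup>2 * (1 + (cmod w)\<^sup>2)"
    proof -
      have "complex_of_real ((norm (V w))\<^sup>2) = of_real ((cmod (k w))\<^sup>2 * (1 + (cmod w)\<^sup>2))"
        unfolding hinner_self[symmetric] hinner_V
        by (simp only: of_real_mult of_real_add of_real_1 complex_norm_square)
      then show ?thesis
        by (simp only: of_real_eq_iff)
    qed
    also have "(cmod (k w))\<^sup>2 = (1 - c\<^sup>2) * (cmod w)\<^sup>2 / (cmod (denom w))\<^sup>2"
      using c_sq by (simp add: k_def norm_mult norm_divide power_mult_distrib power_divide)
    finally have p_eq: "p = 1 - (1 - c\<^sup>2) * (cmod w)\<^sup>2 / (cmod (denom w))\<^sup>2 * (1 + (cmod w)\<^sup>2)"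
      by (simp add: p_def)
    have "d - (1 - c\<^sup>2) * (r + r\<^sup>2) = (1 - (1 - c\<^sup>2) * r / d * (1 + r)) * d" if "d \<noteq> 0" for d r :: real
      using that by (simp add: field_simps power2_eq_square)
    from this[of "(cmod (denom w))\<^sup>2" "(cmod w)\<^sup>2"] show ?thesis
      using W(1) unfolding N_def p_eq denom_def[symmetric] by (simp add: norm_power)
  qed
  have "N > 0"
    using N p W(1) by simp
  then have "N \<le> c * cmod Q"
    unfolding N_def Q_def by (rule cubic_estimate[OF c_pos c_less])
  then have "p * cmod (a * Q) \<le> c * cmod Q"
    unfolding N aQ by (simp add: norm_power)
  moreover have "Q \<noteq> 0"
    using aQ W(1) by auto
  ultimately have pa: "p * cmod a \<le> c"
    by (simp add: norm_mult)
  have "(1 - (cmod z)\<^sup>2) = (1 - (cmod w)\<^sup>2) * p"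
    using potential_identity[OF W(1)] R_f1[OF z] by (simp add: w_def p_def)
  then have "(1 - (cmod z)\<^sup>2)\<^sup>2 * ball_norm_sq (f1 z) a = (p * cmod a)\<^sup>2"
    using W(2) one_minus_norm_sq_pos[OF W(2)]
    by (simp add: w_def[symmetric] ball_norm_sq_complex power_mult_distrib)
  also have "\<dots> \<le> c\<^sup>2"
    using pa p by (intro power_mono) auto
  finally show ?thesis .
qed

lemma f_polarized:
  "x \<in> disc \<Longrightarrow> y \<in> disc \<Longrightarrow> 1 - x * cnj y = (1 - f1 x * cnj (f1 y)) * (1 - hinner (f2 x) (f2 y))"
  using polarized_identity[of "f1 x" "f1 y"] by (simp add: f2_def R_f1 D_facts(1) f1_in_D)

lemma f1_zero: "f1 0 = 0" and f2_zero: "f2 0 = 0"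
  using inj_on_R zero_in_D R_zero V_zero by (auto simp: f1_def f2_def inv_into_f_eq)

lemma f1_deriv_zero: "(f1 has_field_derivative of_real c) (at 0)"
proof -
  obtain a where "(f1 has_field_derivative a) (at 0)" "a * of_real c = (of_real c)\<^sup>2"
    using f1_deriv[of 0] by (auto simp: f1_zero denom_def)
  then show ?thesis
    using c_pos by (simp add: power2_eq_square)
qed

lemma isometry_identity:
  assumes "z \<in> disc" "(f1 has_field_derivative a) (at z)" "(f2 has_derivative (\<lambda>h. h *\<^sub>C b)) (at z)"
  shows "ball_norm_sq z 1 = ball_norm_sq (f1 z) a + ball_norm_sq (f2 z) b"
proof (rule isometry_of_polarized_identity)
  show "cmod (f1 z) < 1" "norm (f2 z) < 1"
    using D_facts[OF f1_in_D[OF assms(1)]] by (simp_all add: f2_def)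
qed (use assms f_polarized in auto)

section \<open>The isometry \<open>F\<close> and the shares of its components\<close>

definition F :: "complex \<Rightarrow> complex \<times> 'a" where "F z = (f1 z, f2 z)"

lemma F_deriv:
  assumes z: "z \<in> disc"
  obtains a b where "(f1 has_field_derivative a) (at z)" "(f2 has_derivative (\<lambda>h. h *\<^sub>C b)) (at z)"
    "(F has_derivative (\<lambda>h. h *\<^sub>C (a, b))) (at z)"
proof -
  obtain a where a: "(f1 has_field_derivative a) (at z)"
    using f1_deriv[OF z] .
  obtain b where b: "(f2 has_derivative (\<lambda>h. h *\<^sub>C b)) (at z)"
    using f2_deriv[OF z] .
  have "(F has_derivative (\<lambda>h. (a * h, h *\<^sub>C b))) (at z)"
    unfolding F_def by (intro has_derivative_Pair has_field_derivative_imp_has_derivative a b)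
  then have "(F has_derivative (\<lambda>h. h *\<^sub>C (a, b))) (at z)"
    by (simp add: scaleC_prod_def scaleC_complex_def mult.commute)
  with a b show ?thesis ..
qed

lemma holomorphic_F: "holomorphic_map_on F disc"
proof (rule holomorphic_map_on_curveI)
  fix z :: complex assume "z \<in> disc"
  from F_deriv[OF this] obtain a b where "(F has_derivative (\<lambda>h. h *\<^sub>C (a, b))) (at z)"
    .
  then show "\<exists>a. (F has_derivative (\<lambda>h. h *\<^sub>C a)) (at z)" ..
qed

lemma F_image: "F ` disc \<subseteq> ball 0 1 \<times> ball 0 1"
proof (rule image_subsetI)
  fix z :: complex assume "z \<in> disc"
  from D_facts[OF f1_in_D[OF this]] show "F z \<in> ball 0 1 \<times> ball 0 1"
    by (simp add: F_def f2_def)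
qed

text \<open>The source is one-dimensional, so all three metrics are the common factor
  \<open>2 * Re (u * cnj v)\<close> times a squared length, and \<open>isometry_identity\<close>
  suffices.\<close>

lemma F_metric:
  assumes z: "z \<in> disc"
  shows "ball_metric z u v = pullback (fst \<circ> F) ball_metric z u v + pullback (snd \<circ> F) ball_metric z u v"
proof -
  obtain a b where a: "(f1 has_field_derivative a) (at z)"
    and b: "(f2 has_derivative (\<lambda>h. h *\<^sub>C b)) (at z)"
    using F_deriv[OF z] .
  have "(f1 has_derivative (\<lambda>h. h *\<^sub>C a)) (at z)"
    using a unfolding has_field_derivative_def
    by (rule has_derivative_eq_rhs) (simp add: scaleC_complex_def fun_eq_iff)
  then have fa: "frechet_derivative f1 (at z) = (\<lambda>h. h *\<^sub>C a)"
    by (rule frechet_derivative_at[symmetric])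
  have fb: "frechet_derivative f2 (at z) = (\<lambda>h. h *\<^sub>C b)"
    using b by (rule frechet_derivative_at[symmetric])
  have comp: "fst \<circ> F = f1" "snd \<circ> F = f2"
    by (simp_all add: F_def fun_eq_iff)
  have metric: "ball_metric p (u *\<^sub>C w) (v *\<^sub>C w) = 2 * Re (u * cnj v) * ball_norm_sq p w"
    if "norm p < 1" for p w :: "'b::{real_inner,complex_normed_vector}"
    unfolding ball_metric_eq[OF that] ball_form_scaleC by simp
  note facts = D_facts[OF f1_in_D[OF z], folded f2_def]
  have "ball_metric z u v = 2 * Re (u * cnj v) * ball_norm_sq z 1"
    using metric[of z 1] z by (simp add: scaleC_complex_def)
  also have "\<dots> = 2 * Re (u * cnj v) * ball_norm_sq (f1 z) a + 2 * Re (u * cnj v) * ball_norm_sq (f2 z) b"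
    unfolding isometry_identity[OF z a b] by (rule distrib_left)
  also have "\<dots> = ball_metric (f1 z) (u *\<^sub>C a) (v *\<^sub>C a) + ball_metric (f2 z) (u *\<^sub>C b) (v *\<^sub>C b)"
    unfolding metric[OF facts(2)] metric[OF facts(4)] ..
  finally show ?thesis
    unfolding pullback_def comp fa fb .
qed

text \<open>The shares of \<open>f1\<close> and \<open>f2\<close> add up to 1, and the first is at
  most \<open>c\<^sup>2\<close>.\<close>

lemma f2_norm_lower:
  assumes z: "z \<in> disc" and b: "(f2 has_derivative (\<lambda>h. h *\<^sub>C b)) (at z)"
  shows "1 - c\<^sup>2 \<le> (1 - (cmod z)\<^sup>2)\<^sup>2 * ball_norm_sq (f2 z) b"
proof -
  obtain a where a: "(f1 has_field_derivative a) (at z)"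
    using f1_deriv[OF z] .
  have "(1 - (cmod z)\<^sup>2)\<^sup>2 * ball_norm_sq z 1 = 1"
    using z one_minus_norm_sq_pos[of z] by (simp add: ball_norm_sq_complex)
  then show ?thesis
    using f1_contraction[OF z a] unfolding isometry_identity[OF z a b] distrib_left by simp
qed

lemma f2_norm_zero:
  assumes "(f2 has_derivative (\<lambda>h. h *\<^sub>C b)) (at 0)"
  shows "(norm b)\<^sup>2 = 1 - c\<^sup>2"
  using isometry_identity[OF _ f1_deriv_zero assms]
  by (simp add: f1_zero f2_zero ball_norm_sq_def)

end

section \<open>Separation of the parameters\<close>

lemma cubic_congruent_le:
  fixes e1 e2 :: "complex ^ 'n"
  assumes "cubic_isometry c e1 e2" and "cubic_isometry c' e1 e2"
    and cong: "congruent_maps (cubic_isometry.F c e1 e2) (cubic_isometry.F c' e1 e2)"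
  shows "c \<le> c'"
proof -
  interpret A: cubic_isometry c e1 e2 by fact
  interpret B: cubic_isometry c' e1 e2 by fact
  obtain a b where a: "(A.f1 has_field_derivative a) (at 0)"
    and b: "(A.f2 has_derivative (\<lambda>h. h *\<^sub>C b)) (at 0)"
    and ab: "(A.F has_derivative (\<lambda>h. h *\<^sub>C (a, b))) (at 0)"
    by (rule A.F_deriv[of 0]) simp_all
  have a_eq: "a = of_real c"
    using a A.f1_deriv_zero by (rule DERIV_unique)
  have nb: "(norm b)\<^sup>2 = 1 - c\<^sup>2"
    using b by (rule A.f2_norm_zero)
  \<comment> \<open>Since \<open>c\<^sup>2\<close> is below one half,
    \<open>c\<^sup>2 \<le> 1 - c\<^sup>2\<close>, which is the condition
    \<open>norm a \<le> norm b\<close> on the extremal disc.\<close>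
  have "c\<^sup>2 \<le> (1/3)\<^sup>2"
    using A.c_pos A.c_less by (intro power_mono) auto
  then have "c\<^sup>2 \<le> (norm b)\<^sup>2"
    unfolding nb by (simp add: power2_eq_square)
  then have "norm a \<le> norm b"
    unfolding a_eq using A.c_pos by (simp add: power2_le_iff_abs_le)
  moreover have "b \<noteq> 0"
    using nb A.c_sq by auto
  moreover have "A.F 0 = 0"
    by (simp add: A.F_def A.f1_zero A.f2_zero zero_prod_def)
  \<comment> \<open>At the origin the second component of \<open>A.F\<close> has share
    \<open>1 - c\<^sup>2\<close>. Congruence yields a point where that of \<open>B.F\<close> has no
    larger share, while its share is at least \<open>1 - c'\<^sup>2\<close> everywhere.\<close>
  ultimately obtain z b' where z: "z \<in> disc" and "((\<lambda>z. snd (B.F z)) has_derivative (\<lambda>h. h *\<^sub>C b')) (at z)"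
    "(1 - (cmod z)\<^sup>2)\<^sup>2 * ball_norm_sq (snd (B.F z)) b' \<le> (norm b)\<^sup>2"
    by (rule_tac congruent_maps_norm_bound[OF cong _ ab _ _ B.holomorphic_F B.F_image])
  then have "1 - c'\<^sup>2 \<le> 1 - c\<^sup>2"
    using B.f2_norm_lower[OF z, of b'] by (simp add: B.F_def nb)
  then show ?thesis
    using A.c_pos B.c_pos by (simp add: power2_le_iff_abs_le)
qed

lemma scaleC_axis: "c *\<^sub>C axis i x = axis i (c *\<^sub>C x)"
  by (simp add: vec_eq_iff scaleC_vec_def axis_def)

text \<open>Congruence is symmetric for these maps, so the comparison of parameters holds in both
  directions. Any two distinct coordinate axes provide the orthonormal pair.\<close>

lemma incongruent_isometries:
  assumes "CARD('n::finite) \<ge> 2"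
  obtains f :: "real \<Rightarrow> complex \<Rightarrow> complex \<times> (complex ^ 'n)"
  where "\<And>c. \<lbrakk>0 < c; c < 1/3\<rbrakk> \<Longrightarrow> holomorphic_isometry (f c)"
    and "\<And>c c'. \<lbrakk>0 < c; c < 1/3; 0 < c'; c' < 1/3\<rbrakk> \<Longrightarrow> congruent_maps (f c) (f c') \<longleftrightarrow> c = c'"
proof -
  obtain i j :: 'n where ij: "i \<noteq> j"
    using assms card_le_Suc0_iff_eq[of "UNIV :: 'n set"] by force
  define e1 e2 :: "complex ^ 'n" where "e1 = axis i 1" and "e2 = axis j 1"
  have loc: "cubic_isometry c e1 e2" if "0 < c" "c < 1/3" for c
    by standard (use that ij in \<open>simp_all add: e1_def e2_def hinner_def scaleC_axis inner_axis_axis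
      complex_eq_iff scaleC_complex_def\<close>)
  let ?f = "\<lambda>c. cubic_isometry.F c e1 e2"
  show ?thesis
  proof (rule that[of ?f])
    fix c :: real assume "0 < c" "c < 1/3"
    then interpret cubic_isometry c e1 e2
      by (rule loc)
    show "holomorphic_isometry (?f c)"
      unfolding holomorphic_isometry_def by (intro conjI ballI allI holomorphic_F F_image F_metric)
  next
    fix c c' :: real assume c: "0 < c" "c < 1/3" "0 < c'" "c' < 1/3"
    show "congruent_maps (?f c) (?f c') \<longleftrightarrow> c = c'"
    proof
      assume cong: "congruent_maps (?f c) (?f c')"
      then have "congruent_maps (?f c') (?f c)"
        by (rule congruent_maps_sym[OF _ cubic_isometry.F_image[OF loc[OF c(3,4)]]])
      then have "c' \<le> c"
        by (rule cubic_congruent_le[OF loc[OF c(3,4)] loc[OF c(1,2)]])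
      moreover have "c \<le> c'"
        using cong by (rule cubic_congruent_le[OF loc[OF c(1,2)] loc[OF c(3,4)]])
      ultimately show "c = c'"
        by simp
    qed (simp add: congruent_maps_refl)
  qed
qed

theorem proposition17:
  assumes "CARD('n::finite) \<ge> 2"
  shows
    "(\<exists>f :: real \<Rightarrow> complex \<Rightarrow> complex \<times> (complex ^ 'n).
        (\<forall>t. holomorphic_isometry (f t)) \<and>
        (\<forall>s t. s \<noteq> t \<longrightarrow> \<not> congruent_maps (f s) (f t)))
     \<and>
     (\<exists>f :: complex \<Rightarrow> complex \<Rightarrow> complex \<times> (complex ^ 'n).
        let A = {\<xi>. (real CARD('n) - 1) / (real CARD('n) + 1) < cmod \<xi> \<and> cmod \<xi> < 1} in
        (\<forall>\<zeta>\<in>A. holomorphic_isometry (f \<zeta>)) \<and>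
        (\<forall>\<zeta>\<in>A. \<forall>\<zeta>'\<in>A. congruent_maps (f \<zeta>) (f \<zeta>') \<longleftrightarrow> cmod \<zeta> = cmod \<zeta>'))
     \<and>
     (CARD('n) \<ge> 3 \<longrightarrow>
      (\<exists>f :: complex \<Rightarrow> complex \<Rightarrow> complex \<times> (complex ^ 'n).
        (\<forall>\<zeta>\<in>disc - {0}. holomorphic_isometry (f \<zeta>)) \<and>
        (\<forall>\<zeta>\<in>disc - {0}. \<forall>\<zeta>'\<in>disc - {0}.
            congruent_maps (f \<zeta>) (f \<zeta>') \<longleftrightarrow> cmod \<zeta> = cmod \<zeta>')))"
proof -
  obtain f :: "real \<Rightarrow> complex \<Rightarrow> complex \<times> (complex ^ 'n)"
    where iso: "\<And>c. \<lbrakk>0 < c; c < 1/3\<rbrakk> \<Longrightarrow> holomorphic_isometry (f c)"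
      and cong: "\<And>c c'. \<lbrakk>0 < c; c < 1/3; 0 < c'; c' < 1/3\<rbrakk> \<Longrightarrow> congruent_maps (f c) (f c') \<longleftrightarrow> c = c'"
    by (rule incongruent_isometries[OF assms]) (rule that; assumption)
  \<comment> \<open>An injection of the real line into the interval from 0 to 1/3, for part
    (a).\<close>
  define \<gamma> :: "real \<Rightarrow> real" where "\<gamma> t = 1 / (3 * (1 + exp t))" for t
  have \<gamma>: "0 < \<gamma> t" "\<gamma> t < 1/3" for t
    using exp_gt_zero[of t] by (simp_all add: \<gamma>_def add_pos_pos pos_divide_less_eq)
  have \<gamma>_eq: "\<gamma> s = \<gamma> t \<longleftrightarrow> s = t" for s t
  proof -
    have "1 + exp r \<noteq> 0" for r :: real
      using exp_gt_zero[of r] by linarith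
    then show ?thesis
      by (simp add: \<gamma>_def)
  qed
  \<comment> \<open>Serves (b) and (c) alike: it depends on \<open>\<zeta>\<close> through the
    modulus alone, and dividing by 3 moves the modulus into the admissible interval.\<close>
  define g :: "complex \<Rightarrow> complex \<Rightarrow> complex \<times> (complex ^ 'n)" where "g \<zeta> = f (cmod \<zeta> / 3)" for \<zeta>
  have g_iso: "holomorphic_isometry (g \<zeta>)" if "0 < cmod \<zeta>" "cmod \<zeta> < 1" for \<zeta>
    unfolding g_def using that by (intro iso) auto
  have g_cong: "congruent_maps (g \<zeta>) (g \<zeta>') \<longleftrightarrow> cmod \<zeta> = cmod \<zeta>'"
    if "0 < cmod \<zeta>" "cmod \<zeta> < 1" "0 < cmod \<zeta>'" "cmod \<zeta>' < 1" for \<zeta> \<zeta>'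
    unfolding g_def using that cong[of "cmod \<zeta> / 3" "cmod \<zeta>' / 3"] by simp
  \<comment> \<open>The inner radius of the annulus is nonnegative, so 0 lies outside it.\<close>
  have A_pos: "0 < cmod \<zeta>" if "(real CARD('n) - 1) / (real CARD('n) + 1) < cmod \<zeta>" for \<zeta>
    by (rule le_less_trans[OF _ that]) (use assms in simp)
  show ?thesis
  proof (intro conjI impI)
    show "\<exists>f :: real \<Rightarrow> complex \<Rightarrow> complex \<times> (complex ^ 'n).
        (\<forall>t. holomorphic_isometry (f t)) \<and> (\<forall>s t. s \<noteq> t \<longrightarrow> \<not> congruent_maps (f s) (f t))"
    proof (intro exI[of _ "\<lambda>t. f (\<gamma> t)"] conjI allI impI)
      show "holomorphic_isometry (f (\<gamma> t))" for t
        using \<gamma> by (rule iso)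
      show "\<not> congruent_maps (f (\<gamma> s)) (f (\<gamma> t))" if "s \<noteq> t" for s t
        using that unfolding cong[OF \<gamma> \<gamma>] \<gamma>_eq .
    qed
    show "\<exists>f :: complex \<Rightarrow> complex \<Rightarrow> complex \<times> (complex ^ 'n).
        let A = {\<xi>. (real CARD('n) - 1) / (real CARD('n) + 1) < cmod \<xi> \<and> cmod \<xi> < 1} in
        (\<forall>\<zeta>\<in>A. holomorphic_isometry (f \<zeta>)) \<and>
        (\<forall>\<zeta>\<in>A. \<forall>\<zeta>'\<in>A. congruent_maps (f \<zeta>) (f \<zeta>') \<longleftrightarrow> cmod \<zeta> = cmod \<zeta>')"
      unfolding Let_def
      by (intro exI[of _ g] conjI ballI g_iso g_cong) (auto simp del: zero_less_norm_iff intro: A_pos)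
    show "\<exists>f :: complex \<Rightarrow> complex \<Rightarrow> complex \<times> (complex ^ 'n).
        (\<forall>\<zeta>\<in>disc - {0}. holomorphic_isometry (f \<zeta>)) \<and>
        (\<forall>\<zeta>\<in>disc - {0}. \<forall>\<zeta>'\<in>disc - {0}.
            congruent_maps (f \<zeta>) (f \<zeta>') \<longleftrightarrow> cmod \<zeta> = cmod \<zeta>')"
      by (intro exI[of _ g] conjI ballI g_iso g_cong) auto
  qed
qed

end
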